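(* Let $n$ be a positive integer and $u\in\mathbb{C}$. The Pfaffian $\operatorname{Pf}(\boldsymbol{\Phi}(u))$ provides a generating function for the $\mathrm{GL}_n$-invariant differential operators $\varGamma_k$, $k=0,1,\dots,\lfloor n/2\rfloor$; namely, the following identity holds in $\mathscr{PD}(\operatorname{Alt}_n)$: $$\operatorname{Pf}(\boldsymbol{\Phi}(u))=\sum_{k=0}^{\lfloor n/2\rfloor} a_{n-2k}(u)\,\varGamma_k,$$ where, for $m=0,1,2,\dots$, $a_m(u)$ is the monic polynomial in $u$ given by $$a_m(u)=\sum_{k=0}^{\lfloor m/2\rfloor}\frac{m!}{2^{2k}\,(m-2k)!\,k!}\,u^{m-2k}.$$
   Context: $\operatorname{Alt}_n$ is the vector space of alternating $n\times n$ complex matrices $x=(x_{i,j})$, $x_{j,i}=-x_{i,j}$, with coordinates $x_{i,j}$, $1\le i<j\le n$. $\mathscr{PD}(\operatorname{Alt}_n)$ is the ring of differential operators on $\operatorname{Alt}_n$ with polynomial coefficients, acting on the polynomial ring $\mathbb{C}[\operatorname{Alt}_n]$. In $\mathscr{PD}(\operatorname{Alt}_n)$, $x_{i,j}$ denotes the multiplication operator by $x_{i,j}$, and $\partial_{i,j}=\partial/\partial x_{i,j}$ for $i<j$, with $\partial_{j,i}=-\partial_{i,j}$ and $\partial_{i,i}=0$. Let $M=(x_{i,j})$ and $D=(\partial_{i,j})$, alternating $n\times n$ matrices. The group $\mathrm{GL}_n=\mathrm{GL}_n(\mathbb{C})$ acts on $\operatorname{Alt}_n$ by $g.x=gxg^t$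 and on $\mathbb{C}[\operatorname{Alt}_n]$ by $\pi(g)f(x)=f(g^{-1}.x)$; an operator $P\in\mathscr{PD}(\operatorname{Alt}_n)$ is $\mathrm{GL}_n$-invariant if $\pi(g)P\pi(g)^{-1}=P$ for all $g\in \mathrm{GL}_n$. Pfaffian: for an associative (not necessarily commutative) algebra $\mathscr{A}$ over a field of characteristic $0$ and an alternating $2m\times 2m$ matrix $\boldsymbol{A}=(A_{i,j})$, $A_{j,i}=-A_{i,j}\in\mathscr{A}$, $$\operatorname{Pf}(\boldsymbol{A})=\frac{1}{2^m m!}\sum_{\sigma\in\mathfrak{S}_{2m}}\operatorname{sgn}(\sigma)\,A_{\sigma(1),\sigma(2)}A_{\sigma(3),\sigma(4)}\cdots A_{\sigma(2m-1),\sigma(2m)}$$ (products in the order written); the Pfaffian of the empty matrix is $1$. Let $J_m$ be the $m\times m$ matrix with $1$'s on the anti-diagonal and $0$'s elsewhere. A $2n\times 2n$ matrix $\boldsymbol{X}$ is called anti-alternating if $\boldsymbol{X}J_{2n}$ is alternating, and then $\operatorname{Pf}(\boldsymbol{X}):=\operatorname{Pf}(\boldsymbol{X}J_{2n})$. Let $\widetilde{\boldsymbol{\Phi}}(u)$ be the alternating $2n\times 2n$ matrix with entries in $\mathscr{PD}(\operatorname{Alt}_n)$ given in $n\times n$ blocks by $$\widetilde{\boldsymbol{\Phi}}(u)=\begin{bmatrix} M & uJ_n\\ -uJ_n & -J_nDJ_n\end{bmatrix},$$ i.e. for $1\le i,j\le n$ its $(i,j)$ entry is $x_{i,j}$, its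 $(i,2n+1-j)$ entry is $u\delta_{i,j}$, its $(2n+1-i,j)$ entry is $-u\delta_{i,j}$, and its $(2n+1-j,2n+1-i)$ entry is $\partial_{i,j}$. Put $\boldsymbol{\Phi}(u)=\widetilde{\boldsymbol{\Phi}}(u)J_{2n}$, which is anti-alternating, so that $\operatorname{Pf}(\boldsymbol{\Phi}(u))=\operatorname{Pf}(\widetilde{\boldsymbol{\Phi}}(u))$. For $k=0,1,\dots,\lfloor n/2\rfloor$, $$\varGamma_k=\sum_{I\subset\{1,\dots,n\},\,|I|=2k}\operatorname{Pf}(x_I)\operatorname{Pf}(\partial_I),$$ where $x_I$ and $\partial_I$ are the submatrices of $M$ and $D$ with row and column indices in $I$ (in increasing order). It is known that each $\varGamma_k$ is $\mathrm{GL}_n$-invariant. *)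

theory Defs
  imports
    "HOL-Library.Poly_Mapping"
    "HOL-Combinatorics.Permutations"
    "HOL-Computational_Algebra.Polynomial"
    "Jordan_Normal_Form.Matrix"
    "Jordan_Normal_Form.DL_Submatrix"
begin

text \<open>Matrices are those of \<^theory>\<open>Jordan_Normal_Form.Matrix\<close>, so rows and columns are
  numbered from \<open>0\<close>; every index below is one less than in the usual notation
  \<open>x\<^sub>i\<^sub>,\<^sub>j\<close> with \<open>1 \<le> i, j \<le> n\<close>.\<close>

section \<open>Pfaffians over noncommutative rings\<close>

text \<open>The Pfaffian of an alternating matrix of size \<open>2m\<close>. The factors of each product appear in the
  written order, so the entries need not commute.\<close>

definition Pf :: "'a::real_algebra_1 mat \<Rightarrow> 'a" where
  "Pf A = (let m = dim_row A div 2 in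
     (1 / (2 ^ m * fact m)) *\<^sub>R
       (\<Sum>\<sigma> | \<sigma> permutes {0..<2 * m}.
          of_int (sign \<sigma>) * prod_list (map (\<lambda>l. A $$ (\<sigma> (2 * l), \<sigma> (2 * l + 1))) [0..<m])))"

definition exchange_mat :: "nat \<Rightarrow> 'a::zero_neq_one mat" where
  "exchange_mat m = mat m m (\<lambda>(i, j). if i + j + 1 = m then 1 else 0)"

definition Pf_anti :: "'a::real_algebra_1 mat \<Rightarrow> 'a" where
  "Pf_anti X = Pf (X * exchange_mat (dim_row X))"

section \<open>Linear operators on the polynomial ring\<close>

text \<open>Polynomials in variables indexed by pairs: a monomial is a finitely supported exponent
  function, a polynomial a finitely supported family of coefficients.\<close>

type_synonym alt_poly = "((nat \<times> nat) \<Rightarrow>\<^sub>0 nat) \<Rightarrow>\<^sub>0 complex"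

definition pscale :: "complex \<Rightarrow> alt_poly \<Rightarrow> alt_poly" where
  "pscale c p = Poly_Mapping.single 0 c * p"

definition pvar :: "nat \<times> nat \<Rightarrow> alt_poly" where
  "pvar v = Poly_Mapping.single (Poly_Mapping.single v 1) 1"

definition partial_deriv :: "nat \<times> nat \<Rightarrow> alt_poly \<Rightarrow> alt_poly" where
  "partial_deriv v p =
     (\<Sum>m\<in>Poly_Mapping.keys p. Poly_Mapping.single (m - Poly_Mapping.single v 1)
        (of_nat (Poly_Mapping.lookup m v) * Poly_Mapping.lookup p m))"

interpretation pscale: vector_space pscale
  by unfold_locales
    (auto simp: pscale_def algebra_simps single_add mult_single simp flip: mult.assoc)

abbreviation clinear_op :: "(alt_poly \<Rightarrow> alt_poly) \<Rightarrow> bool" where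
  "clinear_op \<equiv> Vector_Spaces.linear pscale pscale"

lemma clinear_op_iff:
  "clinear_op f \<longleftrightarrow> (\<forall>p q. f (p + q) = f p + f q) \<and> (\<forall>c p. f (pscale c p) = pscale c (f p))"
  using pscale.vector_space_axioms by (auto simp: Vector_Spaces.linear_iff)

typedef alt_op = "{f. clinear_op f}"
  morphisms apply_op Abs_alt_op
  by (rule exI[of _ "\<lambda>p. 0"]) (simp add: clinear_op_iff)

setup_lifting type_definition_alt_op

instantiation alt_op :: ring_1
begin

lift_definition zero_alt_op :: alt_op is "\<lambda>p. 0"
  by (simp add: clinear_op_iff)

lift_definition one_alt_op :: alt_op is "\<lambda>p. p"
  by (simp add: clinear_op_iff)

lift_definition plus_alt_op :: "alt_op \<Rightarrow> alt_op \<Rightarrow> alt_op" is "\<lambda>f g p. f p + g p"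
  by (simp add: clinear_op_iff algebra_simps)

lift_definition minus_alt_op :: "alt_op \<Rightarrow> alt_op \<Rightarrow> alt_op" is "\<lambda>f g p. f p - g p"
  by (simp add: clinear_op_iff algebra_simps)

lift_definition uminus_alt_op :: "alt_op \<Rightarrow> alt_op" is "\<lambda>f p. - f p"
  by (simp add: clinear_op_iff algebra_simps)

lift_definition times_alt_op :: "alt_op \<Rightarrow> alt_op \<Rightarrow> alt_op" is "\<lambda>f g p. f (g p)"
  by (simp add: clinear_op_iff)

instance
proof
  show "(0::alt_op) \<noteq> 1"
    by transfer (metis zero_neq_one)
qed (transfer; simp add: clinear_op_iff fun_eq_iff algebra_simps)+

end

lift_definition cscale :: "complex \<Rightarrow> alt_op \<Rightarrow> alt_op" (infixr \<open>*\<^sub>C\<close> 75)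
  is "\<lambda>c f p. pscale c (f p)"
  by (simp add: clinear_op_iff algebra_simps)

instantiation alt_op :: real_algebra_1
begin

definition scaleR_alt_op :: "real \<Rightarrow> alt_op \<Rightarrow> alt_op" where
  "scaleR_alt_op r P = complex_of_real r *\<^sub>C P"

instance
  by standard
    (unfold scaleR_alt_op_def, (transfer; simp add: clinear_op_iff fun_eq_iff algebra_simps)+)

end

section \<open>Differential operators with polynomial coefficients\<close>

text \<open>The coordinates on the space of alternating matrices of size \<open>n\<close> are the variables indexed by
  \<open>(i, j)\<close> with \<open>i < j < n\<close>. The operators below are defined for all indices, and in the polynomial
  ring in all variables, so that \<open>n\<close> can be a term.\<close>

definition mult_op :: "alt_poly \<Rightarrow> alt_op" where
  "mult_op q = Abs_alt_op (\<lambda>p. q * p)"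

lemma apply_mult_op: "apply_op (mult_op q) p = q * p"
  unfolding mult_op_def
  by (subst Abs_alt_op_inverse) (simp_all add: clinear_op_iff pscale_def algebra_simps)

lemma partial_deriv_superset:
  assumes "finite S" "Poly_Mapping.keys p \<subseteq> S"
  shows "partial_deriv v p =
     (\<Sum>m\<in>S. Poly_Mapping.single (m - Poly_Mapping.single v 1)
        (of_nat (Poly_Mapping.lookup m v) * Poly_Mapping.lookup p m))"
  unfolding partial_deriv_def using assms
  by (intro sum.mono_neutral_left) (auto simp: in_keys_iff)

lemma lookup_pscale: "Poly_Mapping.lookup (pscale c p) m = c * Poly_Mapping.lookup p m"
  unfolding pscale_def mult_map_scale_conv_mult[symmetric]
  by (simp add: Poly_Mapping.map.rep_eq when_def)

lift_definition deriv_op :: "nat \<times> nat \<Rightarrow> alt_op" is partial_deriv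
  unfolding clinear_op_iff
proof (intro conjI allI)
  fix v :: "nat \<times> nat" and p q :: alt_poly and c :: complex
  let ?S = "Poly_Mapping.keys p \<union> Poly_Mapping.keys q"
  have "Poly_Mapping.keys (p + q) \<subseteq> ?S"
    by (rule keys_add)
  then show "partial_deriv v (p + q) = partial_deriv v p + partial_deriv v q"
    by (simp add: partial_deriv_superset[of ?S] lookup_add algebra_simps
        single_add sum.distrib)
  have "Poly_Mapping.keys (pscale c p) \<subseteq> Poly_Mapping.keys p"
    by (auto simp: in_keys_iff lookup_pscale)
  then show "partial_deriv v (pscale c p) = pscale c (partial_deriv v p)"
    by (simp add: partial_deriv_superset[of "Poly_Mapping.keys p"] lookup_pscale
        pscale.scale_sum_right)
      (simp add: pscale_def mult_single algebra_simps)
qed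

definition x_op :: "nat \<Rightarrow> nat \<Rightarrow> alt_op" where
  "x_op i j = (if i < j then mult_op (pvar (i, j))
               else if j < i then - mult_op (pvar (j, i)) else 0)"

definition d_op :: "nat \<Rightarrow> nat \<Rightarrow> alt_op" where
  "d_op i j = (if i < j then deriv_op (i, j) else if j < i then - deriv_op (j, i) else 0)"

text \<open>The ring of differential operators with polynomial coefficients on alternating matrices of
  size \<open>n\<close>, as the subalgebra of operators generated by the coordinates and the corresponding
  partial derivatives. Its elements preserve the polynomials in the variables \<open>(i, j)\<close> with
  \<open>i < j < n\<close> and are determined by their action on them.\<close>

inductive_set PD :: "nat \<Rightarrow> alt_op set" for n :: nat where
  scalar: "c *\<^sub>C 1 \<in> PD n"
| x_op: "i < j \<Longrightarrow> j < n \<Longrightarrow> x_op i j \<in> PD n"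
| d_op: "i < j \<Longrightarrow> j < n \<Longrightarrow> d_op i j \<in> PD n"
| add: "P \<in> PD n \<Longrightarrow> Q \<in> PD n \<Longrightarrow> P + Q \<in> PD n"
| mult: "P \<in> PD n \<Longrightarrow> Q \<in> PD n \<Longrightarrow> P * Q \<in> PD n"

definition M_mat :: "nat \<Rightarrow> alt_op mat" where
  "M_mat n = mat n n (\<lambda>(i, j). x_op i j)"

definition D_mat :: "nat \<Rightarrow> alt_op mat" where
  "D_mat n = mat n n (\<lambda>(i, j). d_op i j)"

definition Phi_tilde :: "nat \<Rightarrow> complex \<Rightarrow> alt_op mat" where
  "Phi_tilde n u =
     four_block_mat (M_mat n) ((u *\<^sub>C 1) \<cdot>\<^sub>m exchange_mat n)
       (- ((u *\<^sub>C 1) \<cdot>\<^sub>m exchange_mat n)) (- (exchange_mat n * D_mat n * exchange_mat n))"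

definition Phi :: "nat \<Rightarrow> complex \<Rightarrow> alt_op mat" where
  "Phi n u = Phi_tilde n u * exchange_mat (2 * n)"

definition Gamma_op :: "nat \<Rightarrow> nat \<Rightarrow> alt_op" where
  "Gamma_op n k =
     (\<Sum>I | I \<subseteq> {0..<n} \<and> card I = 2 * k.
        Pf (submatrix (M_mat n) I I) * Pf (submatrix (D_mat n) I I))"

definition a_poly :: "nat \<Rightarrow> complex poly" where
  "a_poly m = (\<Sum>k = 0..m div 2.
     monom (fact m / (2 ^ (2 * k) * fact (m - 2 * k) * fact k)) (m - 2 * k))"

end

theory Submission
  imports Defs "HOL-Combinatorics.Multiset_Permutations"
    "HOL-Computational_Algebra.Formal_Power_Series"
begin

text \<open>Adjoin anticommuting elements \<open>e\<^sub>1, \<dots>, e\<^sub>2\<^sub>n\<close> that commute with the operators, and let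
  \<open>e'\<^sub>i\<close> be \<open>e\<close> with index \<open>2n + 1 - i\<close>. If \<open>\<omega>\<close> is half the sum of all \<open>A\<^sub>i\<^sub>j e\<^sub>i e\<^sub>j\<close>, then \<open>\<omega>\<^sup>k / k!\<close> is the
  sum of \<open>Pf(A\<^sub>I) e\<^sub>I\<close> over \<open>|I| = 2k\<close>, whether or not the entries of \<open>A\<close> commute. For the given block
  matrix \<open>\<omega> = X + Y + uZ\<close>, where \<open>X\<close> and \<open>Y\<close> belong to the blocks of the \<open>x\<^sub>i\<^sub>j\<close> and of the \<open>\<partial>\<^sub>i\<^sub>j\<close> and
  \<open>Z = \<Sum> e\<^sub>i e'\<^sub>i\<close> is central. The canonical commutation relations become \<open>[Y, X] = Z\<^sup>2 / 2\<close>, hence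
  \<open>exp(t\<omega>) = exp(tX) exp(tY) exp(utZ + t\<^sup>2Z\<^sup>2/4)\<close>. The last factor generates the terms
  \<open>a\<^sub>m(u) Z\<^sup>m / m!\<close>, and in degree \<open>n\<close> only the products \<open>Pf(x\<^sub>I) Pf(\<partial>\<^sub>I)\<close> with the complement of \<open>I\<close>
  taken from \<open>Z\<close> survive.\<close>

section \<open>Normal ordering\<close>

text \<open>The variable \<open>fps_X\<close> plays the part of t in exp(ta). It commutes with every
  coefficient, while the coefficients need not commute with each other.\<close>

definition exp_fps :: "'a::real_algebra_1 \<Rightarrow> 'a fps" where
  "exp_fps a = Abs_fps (\<lambda>n. a ^ n /\<^sub>R fact n)"

lemma of_nat_mult_scaleR: "of_nat n * (x :: 'a::real_algebra_1) = real n *\<^sub>R x"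
  by (simp add: scaleR_conv_of_real)

lemma fps_deriv_exp_fps: "fps_deriv (exp_fps a) = fps_const a * exp_fps a"
proof (rule fps_ext)
  fix n
  have "inverse (fact (Suc n)) * real (Suc n) = inverse (fact n)"
    by (simp add: field_simps del: of_nat_Suc)
  then show "fps_nth (fps_deriv (exp_fps a)) n = fps_nth (fps_const a * exp_fps a) n"
    unfolding fps_deriv_nth exp_fps_def fps_mult_left_const_nth fps_nth_Abs_fps
    by (simp only: Suc_eq_plus1[symmetric] of_nat_mult_scaleR scaleR_scaleR power_Suc
        mult_scaleR_right mult.commute[of "real _"])
qed

lemma fps_const_commute:
  fixes f :: "'a::ring_1 fps"
  assumes "\<And>n. a * fps_nth f n = fps_nth f n * a"
  shows "fps_const a * f = f * fps_const a"
  by (rule fps_ext) (simp add: assms)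

text \<open>Each passage of Y across a factor X costs one W, and W slides freely through X. For n =
  0 the truncated exponent is harmless because of the factor n.\<close>

lemma commute_power_commutator:
  fixes X Y W :: "'a::real_algebra_1"
  assumes "Y * X = X * Y + W" "W * X = X * W"
  shows "X ^ n * Y = Y * X ^ n - real n *\<^sub>R (W * X ^ (n - 1))"
proof (induction n)
  case (Suc n)
  have "X * (W * X ^ (n - 1)) = W * X ^ n" if "n > 0"
  proof -
    have "X * (W * X ^ (n - 1)) = W * X ^ Suc (n - 1)"
      by (simp add: assms(2) mult.assoc[symmetric])
    then show ?thesis using that by simp
  qed
  then have *: "real n *\<^sub>R (X * (W * X ^ (n - 1))) = real n *\<^sub>R (W * X ^ n)"
    by (metis gr0I of_nat_0 scaleR_zero_left)
  have "X ^ Suc n * Y = X * (X ^ n * Y)"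
    by (simp add: mult.assoc)
  also have "\<dots> = X * Y * X ^ n - real n *\<^sub>R (W * X ^ n)"
    by (simp only: Suc.IH right_diff_distrib mult_scaleR_right * mult.assoc)
  also have "X * Y = Y * X - W"
    using assms(1) by simp
  also have "(Y * X - W) * X ^ n - real n *\<^sub>R (W * X ^ n)
      = Y * X ^ Suc n - real (Suc n) *\<^sub>R (W * X ^ (Suc n - 1))"
    by (simp add: algebra_simps)
  finally show ?case .
qed simp

text \<open>This is exp(tX) Y exp(-tX) = Y - tW written without inverses: the series of iterated
  commutators stops after one step because W commutes with X.\<close>

lemma exp_fps_commutator:
  fixes X Y W :: "'a::real_algebra_1"
  assumes "Y * X = X * Y + W" "W * X = X * W"
  shows "exp_fps X * fps_const Y = (fps_const Y - fps_const W * fps_X) * exp_fps X"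
proof (rule fps_ext)
  fix n
  have "fps_nth (fps_const W * (fps_X * exp_fps X)) n = real n *\<^sub>R (W * X ^ (n - 1)) /\<^sub>R fact n"
  proof (cases n)
    case (Suc k)
    have "inverse (fact (Suc k)) * real (Suc k) = inverse (fact k)"
      by (simp add: field_simps del: of_nat_Suc)
    with Suc show ?thesis
      by (simp add: exp_fps_def del: fact_Suc of_nat_Suc)
  qed simp
  then show "fps_nth (exp_fps X * fps_const Y) n
      = fps_nth ((fps_const Y - fps_const W * fps_X) * exp_fps X) n"
    by (simp add: left_diff_distrib mult.assoc commute_power_commutator[OF assms]
        scaleR_diff_right exp_fps_def)
qed

text \<open>The three-term recurrence of \<open>g\<close> says that its generating series solves
  \<open>G' = (C + t W) G\<close>; then \<open>F = exp (t X) exp (t Y) G\<close> solves \<open>F' = (X + Y + C) F\<close>.\<close>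

lemma power_sum_normal_ordering:
  fixes X Y C W :: "'a::real_algebra_1"
  assumes YX: "Y * X = X * Y + W"
    and W: "W * X = X * W" "W * Y = Y * W" and C: "C * X = X * C" "C * Y = Y * C"
    and g0: "g 0 = 1"
    and g_Suc: "\<And>m. real (Suc m) *\<^sub>R g (Suc m) = C * g m + (if m = 0 then 0 else W * g (m - 1))"
  shows "(X + Y + C) ^ n /\<^sub>R fact n
    = (\<Sum>i=0..n. X ^ i /\<^sub>R fact i * (\<Sum>j=0..n-i. Y ^ j /\<^sub>R fact j * g (n - i - j)))"
proof -
  let ?G = "Abs_fps g" and ?V = "fps_const C + fps_const W * fps_X"
  define F where "F = exp_fps X * (exp_fps Y * ?G)"
  have G': "fps_deriv ?G = ?V * ?G"
    by (rule fps_ext)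
      (simp add: distrib_right mult.assoc of_nat_mult_scaleR g_Suc flip: of_nat_Suc)
  have commute: "?V * exp_fps Z = exp_fps Z * ?V" if "C * Z = Z * C" "W * Z = Z * W" for Z
  proof -
    have "fps_const c * exp_fps Z = exp_fps Z * fps_const c" if "c * Z = Z * c" for c
      using that power_commuting_commutes[of Z c]
      by (intro fps_const_commute) (simp add: exp_fps_def)
    from this[OF that(1)] this[OF that(2)]
    have C: "fps_const C * exp_fps Z = exp_fps Z * fps_const C"
      and W: "fps_const W * exp_fps Z = exp_fps Z * fps_const W" .
    have "fps_const W * fps_X * exp_fps Z = fps_const W * exp_fps Z * fps_X"
      by (simp only: mult.assoc fps_mult_fps_X_commute)
    with C W show ?thesis
      by (simp only: distrib_left distrib_right mult.assoc)
  qed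
  have "fps_deriv F = exp_fps X * (exp_fps Y * (?V * ?G)) + exp_fps X * (fps_const Y * (exp_fps Y * ?G))
      + fps_const X * F"
    unfolding F_def by (simp add: fps_deriv_exp_fps G' distrib_left mult.assoc)
  also have "exp_fps X * (exp_fps Y * (?V * ?G)) = ?V * F"
  proof -
    have "exp_fps X * (exp_fps Y * (?V * ?G)) = exp_fps X * (exp_fps Y * ?V) * ?G"
      by (simp only: mult.assoc)
    also have "\<dots> = exp_fps X * ?V * exp_fps Y * ?G"
      by (simp only: mult.assoc flip: commute[OF C(2) W(2)])
    also have "\<dots> = ?V * F"
      by (simp only: F_def mult.assoc flip: commute[OF C(1) W(1)])
    finally show ?thesis .
  qed
  also have "exp_fps X * (fps_const Y * (exp_fps Y * ?G)) = (fps_const Y - fps_const W * fps_X) * F"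
    by (simp only: F_def exp_fps_commutator[OF YX W(1)] flip: mult.assoc)
  \<comment> \<open>The term -tW that arises when Y moves left past exp(tX) cancels the tW of
    \<open>?V\<close>, which leaves the constant coefficient X + Y + C.\<close>
  finally have F': "fps_deriv F = fps_const (X + Y + C) * F"
    by (simp add: algebra_simps flip: fps_const_add)
  \<comment> \<open>The differential equation and the constant term 1 determine all coefficients of
    F recursively.\<close>
  have "fps_nth F n = (X + Y + C) ^ n /\<^sub>R fact n" for n
  proof (induction n)
    case 0
    then show ?case by (simp add: F_def exp_fps_def g0)
  next
    case (Suc n)
    have "real (Suc n) *\<^sub>R fps_nth F (Suc n) = (X + Y + C) * fps_nth F n"
      using arg_cong[OF F', of "\<lambda>f. fps_nth f n"] by (simp add: of_nat_mult_scaleR flip: of_nat_Suc)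
    then have "real (Suc n) *\<^sub>R fps_nth F (Suc n) = (X + Y + C) ^ Suc n /\<^sub>R fact n"
      by (simp add: Suc)
    from arg_cong[OF this, of "\<lambda>x. x /\<^sub>R real (Suc n)"]
    show ?case by (simp add: mult.commute del: of_nat_Suc power_Suc)
  qed
  then show ?thesis
    by (simp add: F_def fps_mult_nth exp_fps_def flip: diff_diff_left)
qed

section \<open>Powers of quadratic elements in anticommuting generators\<close>

text \<open>The case i = j is included; over a real algebra it makes every square vanish.\<close>

definition anticommuting :: "(nat \<Rightarrow> 'a::ring) \<Rightarrow> bool" where
  "anticommuting f \<longleftrightarrow> (\<forall>i j. f i * f j = - (f j * f i))"

lemma anticommutingD: "anticommuting f \<Longrightarrow> f i * f j = - (f j * f i)"
  unfolding anticommuting_def by blast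

lemma anticommuting_square:
  fixes f :: "nat \<Rightarrow> 'a::real_algebra_1"
  assumes "anticommuting f"
  shows "f i * f i = 0"
proof -
  have "2 *\<^sub>R (f i * f i) = 0"
    using anticommutingD[OF assms, of i i] by (simp add: scaleR_2 eq_neg_iff_add_eq_0)
  then show ?thesis by simp
qed

lemma anticommuting_comp: "anticommuting f \<Longrightarrow> anticommuting (f \<circ> g)"
  unfolding anticommuting_def comp_apply by blast

lemma anticommuting_move:
  fixes f :: "nat \<Rightarrow> 'a::real_algebra_1"
  assumes "anticommuting f"
  shows "f a * prod_list (map f xs) = (- 1) ^ length xs * (prod_list (map f xs) * f a)"
proof (induction xs)
  case (Cons x xs)
  have "f a * prod_list (map f (x # xs)) = - (f x * (f a * prod_list (map f xs)))"
    using anticommutingD[OF assms, of a x] by (simp add: mult.assoc[symmetric])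
  also have "\<dots> = - ((- 1) ^ length xs * (f x * (prod_list (map f xs) * f a)))"
    unfolding Cons.IH by (cases "even (length xs)") simp_all
  finally show ?case by (simp add: mult.assoc)
qed simp

text \<open>A repeated generator can be moved, up to sign, next to its other copy, and its square is
  0.\<close>

lemma anticommuting_prod_not_distinct:
  fixes f :: "nat \<Rightarrow> 'a::real_algebra_1"
  assumes f: "anticommuting f" and "\<not> distinct xs"
  shows "prod_list (map f xs) = 0"
proof -
  obtain us vs ws y where xs: "xs = us @ [y] @ vs @ [y] @ ws"
    using not_distinct_decomp[OF assms(2)] by blast
  have "f y * (prod_list (map f vs) * f y) = (- 1) ^ length vs * (prod_list (map f vs) * (f y * f y))"
    by (simp only: anticommuting_move[OF f, of y vs] mult.assoc flip: mult.assoc[of "f y"])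
  then have "f y * (prod_list (map f vs) * f y) = 0"
    by (simp add: anticommuting_square[OF f])
  moreover have "prod_list (map f xs)
      = prod_list (map f us) * (f y * (prod_list (map f vs) * f y)) * prod_list (map f ws)"
    by (simp add: xs mult.assoc)
  ultimately show ?thesis by simp
qed

text \<open>Moving the left one of the two exchanged generators across the block between them gives
  the same sign before and after the exchange. Only the sign from swapping the two generators
  themselves remains.\<close>

lemma anticommuting_prod_transpose:
  fixes f :: "nat \<Rightarrow> 'a::real_algebra_1"
  assumes f: "anticommuting f" and ab: "a < b" "b < n"
  shows "prod_list (map (f \<circ> transpose a b) [0..<n]) = - prod_list (map f [0..<n])"
proof -
  have app: "[i..<k] = [i..<j] @ [j..<k]" if "i \<le> j" "j \<le> k" for i j k :: nat
    using that upt_add_eq_append[of i j "k - j"] by simp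
  have split: "[0..<n] = [0..<a] @ [a] @ [Suc a..<b] @ [b] @ [Suc b..<n]"
    using ab app[of 0 a n] app[of "Suc a" b n] upt_conv_Cons[of a n] upt_conv_Cons[of b n]
    by simp
  let ?L = "prod_list (map f [Suc a..<b])"
  let ?s = "(- 1) ^ length [Suc a..<b] :: 'a"
  have comm: "?s * x = x * ?s" for x :: 'a
    by (cases "even (length [Suc a..<b])") simp_all
  have "f b * ?L * f a = ?s * (?L * (f b * f a))"
    unfolding anticommuting_move[OF f] by (simp only: mult.assoc)
  also have "\<dots> = - (?s * (?L * (f a * f b)))"
    using anticommutingD[OF f, of b a] by simp
  also have "\<dots> = - (f a * ?L * f b)"
    unfolding anticommuting_move[OF f] by (simp only: mult.assoc)
  finally have main: "f b * ?L * f a = - (f a * ?L * f b)" .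
  have maps: "map (f \<circ> transpose a b) [0..<a] = map f [0..<a]"
       "map (f \<circ> transpose a b) [Suc a..<b] = map f [Suc a..<b]"
       "map (f \<circ> transpose a b) [Suc b..<n] = map f [Suc b..<n]"
       "map (f \<circ> transpose a b) [a] = [f b]" "map (f \<circ> transpose a b) [b] = [f a]"
    using ab by (auto simp: transpose_def)
  have "prod_list (map (f \<circ> transpose a b) [0..<n])
      = prod_list (map f [0..<a]) * (f b * ?L * f a) * prod_list (map f [Suc b..<n])"
    unfolding split map_append prod_list.append maps by (simp add: mult.assoc)
  also have "\<dots> = - prod_list (map f [0..<n])"
    unfolding split map_append prod_list.append main by (simp add: mult.assoc)
  finally show ?thesis .
qed

lemma anticommuting_prod_permute:
  fixes f :: "nat \<Rightarrow> 'a::real_algebra_1"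
  assumes "\<sigma> permutes {0..<n}" "anticommuting f"
  shows "prod_list (map (f \<circ> \<sigma>) [0..<n]) = of_int (sign \<sigma>) * prod_list (map f [0..<n])"
proof -
  \<comment> \<open>The generators are quantified inside the induction because the hypothesis is
    applied to f composed with a transposition.\<close>
  have "\<forall>f :: nat \<Rightarrow> 'a. anticommuting f \<longrightarrow>
      prod_list (map (f \<circ> \<sigma>) [0..<n]) = of_int (sign \<sigma>) * prod_list (map f [0..<n])"
    using assms(1) finite_atLeastLessThan
  proof (induction rule: permutes_induct)
    case (swap a b p)
    show ?case
    proof (intro allI impI)
      fix f :: "nat \<Rightarrow> 'a"
      assume f: "anticommuting f"
      have "prod_list (map (f \<circ> transpose a b) [0..<n]) = - prod_list (map f [0..<n])"
        using swap(1-3) anticommuting_prod_transpose[OF f, of a b n]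
          anticommuting_prod_transpose[OF f, of b a n]
        by (cases "a < b") (simp_all add: transpose_commute)
      moreover have "sign (transpose a b \<circ> p) = - sign p"
        using swap.hyps by (simp add: sign_compose permutation_swap_id sign_swap_id
            permutes_imp_permutation[of "{0..<n}"])
      ultimately show "prod_list (map (f \<circ> (transpose a b \<circ> p)) [0..<n])
          = of_int (sign (transpose a b \<circ> p)) * prod_list (map f [0..<n])"
        using swap.IH[rule_format, OF anticommuting_comp[OF f, of "transpose a b"]]
        by (simp add: o_assoc[symmetric])
    qed
  qed (simp_all add: o_def)
  then show ?thesis using assms(2) by blast
qed

section \<open>Powers of sums as sums over lists and subsets of indices\<close>

lemma sum_power_lists:
  fixes c :: "'b \<Rightarrow> 'a::semiring_1"
  assumes "finite S"
  shows "(\<Sum>i\<in>S. c i) ^ k = (\<Sum>xs | set xs \<subseteq> S \<and> length xs = k. prod_list (map c xs))"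
proof (induction k)
  case 0
  have "{xs. set xs \<subseteq> S \<and> length xs = 0} = {[]}" by auto
  then show ?case by simp
next
  case (Suc k)
  let ?L = "\<lambda>k. {xs. set xs \<subseteq> S \<and> length xs = k}"
  have "bij_betw (\<lambda>(i, xs). i # xs) (S \<times> ?L k) (?L (Suc k))"
    by (auto simp: bij_betw_def inj_on_def image_iff length_Suc_conv)
  from sum.reindex_bij_betw[OF this, of "\<lambda>xs. prod_list (map c xs)"]
  have "(\<Sum>xs\<in>?L (Suc k). prod_list (map c xs))
      = (\<Sum>(i, xs)\<in>S \<times> ?L k. c i * prod_list (map c xs))"
    by (simp add: case_prod_unfold)
  also have "\<dots> = (\<Sum>i\<in>S. c i) * (\<Sum>xs\<in>?L k. prod_list (map c xs))"
    by (simp only: sum_product sum.cartesian_product)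
  finally show ?case
    by (simp only: Suc power_Suc)
qed

text \<open>Reading a list of length 2k as k consecutive pairs gives exactly the index pattern of
  the products in \<open>Pf\<close>.\<close>

lemma sum_power_pair_lists:
  fixes c :: "'b \<Rightarrow> 'b \<Rightarrow> 'a::semiring_1"
  assumes "finite S"
  shows "(\<Sum>i\<in>S. \<Sum>j\<in>S. c i j) ^ k
    = (\<Sum>xs | set xs \<subseteq> S \<and> length xs = 2 * k.
        prod_list (map (\<lambda>l. c (xs ! (2 * l)) (xs ! (2 * l + 1))) [0..<k]))"
proof (induction k)
  case 0
  have "{xs. set xs \<subseteq> S \<and> length xs = 0} = {[]}" by auto
  then show ?case by simp
next
  case (Suc k)
  let ?L = "\<lambda>k. {xs. set xs \<subseteq> S \<and> length xs = 2 * k}"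
  let ?g = "\<lambda>k xs. prod_list (map (\<lambda>l. c (xs ! (2 * l)) (xs ! (2 * l + 1))) [0..<k])"
  have bij: "bij_betw (\<lambda>((i, j), xs). i # j # xs) ((S \<times> S) \<times> ?L k) (?L (Suc k))"
    by (auto simp: bij_betw_def inj_on_def image_iff length_Suc_conv)
  have g: "?g (Suc k) (i # j # xs) = c i j * ?g k xs" for i j xs
    unfolding upt_conv_Cons[OF zero_less_Suc] map_Suc_upt[symmetric] by (simp add: o_def)
  have "(\<Sum>xs\<in>?L (Suc k). ?g (Suc k) xs)
      = (\<Sum>(p, xs)\<in>(S \<times> S) \<times> ?L k. case_prod c p * ?g k xs)"
    unfolding sum.reindex_bij_betw[OF bij, symmetric]
    by (rule sum.cong) (auto simp only: g split: prod.splits)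
  also have "\<dots> = (\<Sum>p\<in>S \<times> S. case_prod c p) * (\<Sum>xs\<in>?L k. ?g k xs)"
    by (simp only: sum_product sum.cartesian_product)
  also have "(\<Sum>p\<in>S \<times> S. case_prod c p) = (\<Sum>i\<in>S. \<Sum>j\<in>S. c i j)"
    by (simp add: sum.cartesian_product)
  finally show ?case
    by (simp only: Suc power_Suc)
qed

text \<open>The lists that survive are the orderings of the k-element subsets, so the sum can be
  grouped by the underlying set.\<close>

lemma sum_lists_distinct:
  fixes g :: "'b list \<Rightarrow> 'a::comm_monoid_add"
  assumes "finite S" and "\<And>xs. \<not> distinct xs \<Longrightarrow> g xs = 0"
  shows "(\<Sum>xs | set xs \<subseteq> S \<and> length xs = k. g xs)
    = (\<Sum>I | I \<subseteq> S \<and> card I = k. \<Sum>xs\<in>permutations_of_set I. g xs)"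
proof -
  have "(\<Sum>xs | set xs \<subseteq> S \<and> length xs = k. g xs)
      = (\<Sum>xs\<in>(\<Union>I\<in>{I. I \<subseteq> S \<and> card I = k}. permutations_of_set I). g xs)"
  proof (rule sum.mono_neutral_right)
    show "finite {xs. set xs \<subseteq> S \<and> length xs = k}"
      using assms(1) by (rule finite_lists_length_eq)
    show "(\<Union>I\<in>{I. I \<subseteq> S \<and> card I = k}. permutations_of_set I) \<subseteq> {xs. set xs \<subseteq> S \<and> length xs = k}"
      by (auto simp: permutations_of_set_def distinct_card)
    show "\<forall>xs\<in>{xs. set xs \<subseteq> S \<and> length xs = k} - (\<Union>I\<in>{I. I \<subseteq> S \<and> card I = k}. permutations_of_set I). g xs = 0"
      using assms(2) by (auto simp: permutations_of_set_def) (metis distinct_card)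
  qed
  also have "\<dots> = (\<Sum>I | I \<subseteq> S \<and> card I = k. \<Sum>xs\<in>permutations_of_set I. g xs)"
    using assms(1)
    by (subst sum.UNION_disjoint) (auto dest: permutations_of_setD intro: finite_subset)
  finally show ?thesis .
qed

text \<open>Links the numbering of rows by \<open>submatrix\<close>, which uses \<open>pick\<close>,
  with the increasing order of the generators in \<open>ordered_prod\<close>.\<close>

lemma pick_upt_eq_sorted_list:
  assumes "finite I"
  shows "map (pick I) [0..<card I] = sorted_list_of_set I"
proof (rule strict_sorted_equal[symmetric])
  show "sorted_wrt (<) (map (pick I) [0..<card I])"
    by (auto simp: sorted_wrt_iff_nth_less intro: pick_mono_le)
  have "inj_on (pick I) {0..<card I}"
    by (intro inj_onI) (metis atLeastLessThan_iff nat_neq_iff pick_mono_le)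
  moreover have "pick I ` {0..<card I} \<subseteq> I"
    by (auto intro: pick_in_set_le)
  ultimately have "pick I ` {0..<card I} = I"
    using assms by (intro card_subset_eq) (auto simp: card_image)
  then show "set (sorted_list_of_set I) = set (map (pick I) [0..<card I])"
    using assms by simp
qed simp

text \<open>Replaces orderings of I by permutations of positions, over which \<open>Pf\<close> sums.
  The map is injective, and equal cardinalities give surjectivity.\<close>

lemma sum_permutations_of_set_permutes:
  fixes g :: "nat list \<Rightarrow> 'a::comm_monoid_add"
  assumes "finite I"
  shows "(\<Sum>xs\<in>permutations_of_set I. g xs)
    = (\<Sum>\<sigma> | \<sigma> permutes {0..<card I}. g (map (pick I \<circ> \<sigma>) [0..<card I]))"
proof -
  let ?P = "{\<sigma>. \<sigma> permutes {0..<card I}}" and ?h = "\<lambda>\<sigma>. map (pick I \<circ> \<sigma>) [0..<card I]"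
  have pick: "inj_on (pick I) {0..<card I}" "pick I ` {0..<card I} = I"
  proof -
    have "distinct (map (pick I) [0..<card I])"
      by (simp only: pick_upt_eq_sorted_list[OF assms]
          sorted_list_of_set.distinct_sorted_key_list_of_set)
    then show "inj_on (pick I) {0..<card I}"
      by (simp add: distinct_map)
    show "pick I ` {0..<card I} = I"
      using arg_cong[OF pick_upt_eq_sorted_list[OF assms], of set] assms
      by (simp only: set_map set_upt set_sorted_list_of_set)
  qed
  have inj: "inj_on ?h ?P"
  proof (rule inj_onI)
    fix \<sigma> \<tau> assume *: "\<sigma> \<in> ?P" "\<tau> \<in> ?P" "?h \<sigma> = ?h \<tau>"
    show "\<sigma> = \<tau>"
    proof
      fix i
      show "\<sigma> i = \<tau> i"
      proof (cases "i < card I")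
        case True
        then have "pick I (\<sigma> i) = pick I (\<tau> i)"
          using *(3) by simp
        moreover have "\<sigma> i \<in> {0..<card I}" "\<tau> i \<in> {0..<card I}"
          using True *(1,2) permutes_in_image by fastforce+
        ultimately show ?thesis using pick(1) by (simp add: inj_on_def)
      next
        case False
        then show ?thesis using *(1,2) by (simp add: permutes_not_in)
      qed
    qed
  qed
  have "?h ` ?P \<subseteq> permutations_of_set I"
  proof
    fix xs assume "xs \<in> ?h ` ?P"
    then obtain \<sigma> where \<sigma>: "\<sigma> permutes {0..<card I}" and xs: "xs = ?h \<sigma>"
      by blast
    have "set (?h \<sigma>) = pick I ` (\<sigma> ` {0..<card I})"
      by (simp add: image_comp)
    also have "\<dots> = I"
      using pick(2) permutes_image[OF \<sigma>] by simp
    finally have "set (?h \<sigma>) = I" .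
    moreover have "distinct (?h \<sigma>)"
      using pick(1) permutes_inj_on[OF \<sigma>] permutes_image[OF \<sigma>]
      by (simp add: distinct_map comp_inj_on)
    ultimately show "xs \<in> permutations_of_set I"
      unfolding xs by (rule permutations_of_setI)
  qed
  moreover have "card (?h ` ?P) = card (permutations_of_set I)"
    using assms by (simp add: card_image[OF inj] card_permutations)
  ultimately have "?h ` ?P = permutations_of_set I"
    using assms by (intro card_subset_eq) simp_all
  then show ?thesis
    using sum.reindex[OF inj, of g] by (simp add: o_def)
qed

section \<open>Ordered monomials and powers of commuting elements\<close>

text \<open>For anticommuting generators and finite I this is the monomial e_I of the exterior
  algebra, its factors in increasing order.\<close>

definition ordered_prod :: "(nat \<Rightarrow> 'a::monoid_mult) \<Rightarrow> nat set \<Rightarrow> 'a" where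
  "ordered_prod f I = prod_list (map f (sorted_list_of_set I))"

lemma prod_list_commute:
  fixes y :: "'a::monoid_mult"
  assumes "\<And>x. x \<in> set xs \<Longrightarrow> x * y = y * x"
  shows "prod_list xs * y = y * prod_list xs"
  using assms
proof (induction xs)
  case (Cons x xs)
  then have "prod_list xs * y = y * prod_list xs" and "x * y = y * x"
    by simp_all
  then show ?case
    by (simp add: mult.assoc) (simp flip: mult.assoc)
qed simp

lemma ordered_prod_commute:
  assumes "finite I" and "\<And>i. i \<in> I \<Longrightarrow> f i * y = y * f i"
  shows "ordered_prod f I * y = y * ordered_prod f I"
  unfolding ordered_prod_def using assms by (intro prod_list_commute) auto

lemma prod_list_commuting_perm:
  fixes z :: "'b \<Rightarrow> 'a::monoid_mult"
  assumes z: "\<And>i j. z i * z j = z j * z i" and "mset xs = mset ys"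
  shows "prod_list (map z xs) = prod_list (map z ys)"
  using assms(2)
proof (induction xs arbitrary: ys)
  case (Cons x xs)
  then have "x \<in> set ys"
    by (metis list.set_intros(1) set_mset_mset)
  then obtain us vs where ys: "ys = us @ x # vs"
    by (meson split_list)
  have "mset xs = mset (us @ vs)"
    using Cons.prems ys by simp
  from Cons.IH[OF this] have "prod_list (map z (x # xs)) = z x * prod_list (map z us) * prod_list (map z vs)"
    by (simp add: mult.assoc)
  also have "z x * prod_list (map z us) = prod_list (map z us) * z x"
    by (intro prod_list_commute[symmetric]) (use z in auto)
  finally show ?case
    by (simp add: ys mult.assoc)
qed simp

text \<open>Lists with a repetition vanish since squares are 0, and the k! orderings of each set K
  give the same product. This yields the powers of the central element Z.\<close>

lemma sum_power_commuting:
  fixes z :: "nat \<Rightarrow> 'a::real_algebra_1"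
  assumes z: "\<And>i j. z i * z j = z j * z i" and z0: "\<And>i. z i * z i = 0" and S: "finite S"
  shows "(\<Sum>i\<in>S. z i) ^ k /\<^sub>R fact k = (\<Sum>K | K \<subseteq> S \<and> card K = k. ordered_prod z K)"
proof -
  have "prod_list (map z xs) = 0" if nd: "\<not> distinct xs" for xs
  proof -
    obtain us vs ws y where xs: "xs = us @ [y] @ vs @ [y] @ ws"
      using not_distinct_decomp[OF nd] by blast
    then have "prod_list (map z xs) = prod_list (map z (y # y # us @ vs @ ws))"
      by (intro prod_list_commuting_perm[OF z]) simp
    then show ?thesis
      using z0 by (simp flip: mult.assoc)
  qed
  then have "(\<Sum>i\<in>S. z i) ^ k
      = (\<Sum>K | K \<subseteq> S \<and> card K = k. \<Sum>xs\<in>permutations_of_set K. prod_list (map z xs))"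
    by (simp add: sum_power_lists[OF S] sum_lists_distinct[OF S])
  also have "\<dots> = (\<Sum>K | K \<subseteq> S \<and> card K = k. fact k *\<^sub>R ordered_prod z K)"
  proof (rule sum.cong[OF refl])
    fix K assume "K \<in> {K. K \<subseteq> S \<and> card K = k}"
    then have K: "finite K" "card K = k"
      using S finite_subset by auto
    have "prod_list (map z xs) = ordered_prod z K" if "xs \<in> permutations_of_set K" for xs
      unfolding ordered_prod_def using permutations_of_setD[OF that] K
      by (intro prod_list_commuting_perm[OF z]) (simp add: mset_set_set[symmetric])
    then show "(\<Sum>xs\<in>permutations_of_set K. prod_list (map z xs)) = fact k *\<^sub>R ordered_prod z K"
      using K by (simp add: scaleR_conv_of_real)
  qed
  finally show ?thesis
    by (simp add: scaleR_sum_right[symmetric])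
qed

section \<open>Pfaffian minors as coefficients of powers\<close>

text \<open>Moves the choice of I from the matrix into the indices, the form in which the terms of
  an expanded power appear.\<close>

lemma Pf_submatrix:
  assumes "I \<subseteq> {0..<n}" "card I = 2 * k"
  shows "Pf (submatrix (mat n n (\<lambda>(i, j). a i j)) I I) = (1 / (2 ^ k * fact k)) *\<^sub>R
    (\<Sum>\<sigma> | \<sigma> permutes {0..<2 * k}. of_int (sign \<sigma>) *
      prod_list (map (\<lambda>l. a (pick I (\<sigma> (2 * l))) (pick I (\<sigma> (2 * l + 1)))) [0..<k]))"
proof -
  let ?A = "submatrix (mat n n (\<lambda>(i, j). a i j)) I I"
  have "{i. i < n \<and> i \<in> I} = I"
    using assms(1) by auto
  then have dim: "card {i. i < n \<and> i \<in> I} = 2 * k"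
    using assms(2) by simp
  have entry: "?A $$ (i, j) = a (pick I i) (pick I j)" if "i < 2 * k" "j < 2 * k" for i j
    using that assms pick_in_set_le[of i I] pick_in_set_le[of j I]
    by (subst submatrix_index) (auto simp: dim subset_eq)
  have "prod_list (map (\<lambda>l. ?A $$ (\<sigma> (2 * l), \<sigma> (2 * l + 1))) [0..<k])
      = prod_list (map (\<lambda>l. a (pick I (\<sigma> (2 * l))) (pick I (\<sigma> (2 * l + 1)))) [0..<k])"
    if "\<sigma> permutes {0..<2 * k}" for \<sigma>
  proof -
    have "\<sigma> i < 2 * k" if "i < 2 * k" for i
      using permutes_in_image[OF \<open>\<sigma> permutes {0..<2 * k}\<close>, of i] that by simp
    then show ?thesis
      by (intro arg_cong[where f = prod_list] map_cong refl entry) auto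
  qed
  then show ?thesis
    by (simp add: Pf_def Let_def dim_submatrix dim)
qed

text \<open>The generators can all be collected on the right without disturbing the order of the
  coefficients, because each coefficient commutes with each generator.\<close>

lemma prod_list_pairs:
  fixes f :: "nat \<Rightarrow> 'a::monoid_mult"
  assumes "\<And>i j k. a i j * f k = f k * a i j"
  shows "prod_list (map (\<lambda>l. a (h (2 * l)) (h (2 * l + 1)) * (f (h (2 * l)) * f (h (2 * l + 1)))) [0..<k])
    = prod_list (map (\<lambda>l. a (h (2 * l)) (h (2 * l + 1))) [0..<k]) * prod_list (map (f \<circ> h) [0..<2 * k])"
proof (induction k)
  case (Suc k)
  let ?P = "prod_list (map (\<lambda>l. a (h (2 * l)) (h (2 * l + 1))) [0..<k])"
  let ?F = "prod_list (map (f \<circ> h) [0..<2 * k])" and ?a = "a (h (2 * k)) (h (2 * k + 1))"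
  let ?f = "f (h (2 * k)) * f (h (2 * k + 1))"
  have "?P * ?F * (?a * ?f) = ?P * (?F * ?a) * ?f"
    by (simp only: mult.assoc)
  also have "?F * ?a = ?a * ?F"
    by (intro prod_list_commute) (auto simp: assms)
  also have "?P * (?a * ?F) * ?f = ?P * ?a * (?F * ?f)"
    by (simp only: mult.assoc)
  finally show ?case
    using Suc.IH by (simp add: mult.assoc o_def)
qed simp

lemma power_scaleR: "(c *\<^sub>R x) ^ k = c ^ k *\<^sub>R (x :: 'a::real_algebra_1) ^ k"
  by (induction k) simp_all

text \<open>Expand the power over lists of 2k indices. Sorting the generators of a list without
  repetition into \<open>ordered_prod f I\<close> produces the sign in \<open>Pf\<close>, and the
  factors 1/2^k and 1/k! are its normalisation.\<close>

lemma Pf_power: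
  fixes f :: "nat \<Rightarrow> 'a::real_algebra_1"
  assumes f: "anticommuting f" and comm: "\<And>i j k. a i j * f k = f k * a i j"
  shows "((1 / 2) *\<^sub>R (\<Sum>i\<in>{0..<n}. \<Sum>j\<in>{0..<n}. a i j * (f i * f j))) ^ k /\<^sub>R fact k
    = (\<Sum>I | I \<subseteq> {0..<n} \<and> card I = 2 * k.
        Pf (submatrix (mat n n (\<lambda>(i, j). a i j)) I I) * ordered_prod f I)"
proof -
  let ?p = "\<lambda>xs. prod_list (map (\<lambda>l. a (xs ! (2 * l)) (xs ! (2 * l + 1))) [0..<k])"
  let ?g = "\<lambda>xs. ?p xs * prod_list (map f xs)"
  have "(\<Sum>i\<in>{0..<n}. \<Sum>j\<in>{0..<n}. a i j * (f i * f j)) ^ k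
      = (\<Sum>xs | set xs \<subseteq> {0..<n} \<and> length xs = 2 * k. ?g xs)"
    unfolding sum_power_pair_lists[OF finite_atLeastLessThan]
  proof (rule sum.cong[OF refl])
    fix xs assume "xs \<in> {xs. set xs \<subseteq> {0..<n} \<and> length xs = 2 * k}"
    then have "map (f \<circ> (!) xs) [0..<2 * k] = map f xs"
      by (metis (mono_tags, lifting) map_map map_nth mem_Collect_eq)
    then show "prod_list (map (\<lambda>l. a (xs ! (2 * l)) (xs ! (2 * l + 1))
        * (f (xs ! (2 * l)) * f (xs ! (2 * l + 1)))) [0..<k]) = ?g xs"
      using prod_list_pairs[of a f "(!) xs" k, OF comm] by simp
  qed
  also have "\<dots> = (\<Sum>I | I \<subseteq> {0..<n} \<and> card I = 2 * k. \<Sum>xs\<in>permutations_of_set I. ?g xs)"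
    by (rule sum_lists_distinct) (simp_all add: anticommuting_prod_not_distinct[OF f])
  also have "\<dots> = (\<Sum>I | I \<subseteq> {0..<n} \<and> card I = 2 * k. (2 ^ k * fact k) *\<^sub>R
      (Pf (submatrix (mat n n (\<lambda>(i, j). a i j)) I I) * ordered_prod f I))"
  proof (rule sum.cong[OF refl])
    fix I assume "I \<in> {I. I \<subseteq> {0..<n} \<and> card I = 2 * k}"
    then have I: "I \<subseteq> {0..<n}" "card I = 2 * k" and fin: "finite I"
      using finite_subset by auto
    let ?q = "\<lambda>\<sigma>. prod_list (map (\<lambda>l. a (pick I (\<sigma> (2 * l))) (pick I (\<sigma> (2 * l + 1)))) [0..<k])"
    have "?g (map (pick I \<circ> \<sigma>) [0..<2 * k]) = of_int (sign \<sigma>) * ?q \<sigma> * ordered_prod f I"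
      if \<sigma>: "\<sigma> permutes {0..<2 * k}" for \<sigma>
    proof -
      have "?p (map (pick I \<circ> \<sigma>) [0..<2 * k]) = ?q \<sigma>"
        by (intro arg_cong[where f = prod_list] map_cong refl) auto
      moreover have "prod_list (map f (map (pick I \<circ> \<sigma>) [0..<2 * k]))
          = of_int (sign \<sigma>) * ordered_prod f I"
        using anticommuting_prod_permute[OF \<sigma> anticommuting_comp[OF f, of "pick I"]]
        by (simp add: ordered_prod_def I flip: pick_upt_eq_sorted_list[OF fin] o_assoc)
      ultimately show ?thesis
        by (simp add: mult_of_int_commute mult.assoc)
    qed
    then show "(\<Sum>xs\<in>permutations_of_set I. ?g xs)
        = (2 ^ k * fact k) *\<^sub>R (Pf (submatrix (mat n n (\<lambda>(i, j). a i j)) I I) * ordered_prod f I)"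
      unfolding sum_permutations_of_set_permutes[OF fin] I(2) Pf_submatrix[OF I]
      by (simp add: sum_distrib_right)
  qed
  finally have "(\<Sum>i\<in>{0..<n}. \<Sum>j\<in>{0..<n}. a i j * (f i * f j)) ^ k
      = (2 ^ k * fact k) *\<^sub>R (\<Sum>I | I \<subseteq> {0..<n} \<and> card I = 2 * k.
          Pf (submatrix (mat n n (\<lambda>(i, j). a i j)) I I) * ordered_prod f I)"
    by (simp add: scaleR_sum_right)
  then show ?thesis
    by (simp add: power_one_over inverse_eq_divide power_scaleR)
qed

lemma Pf_submatrix_commute:
  fixes y :: "'a::real_algebra_1"
  assumes I: "I \<subseteq> {0..<n}" "card I = 2 * k" and y: "\<And>i j. a i j * y = y * a i j"
  shows "Pf (submatrix (mat n n (\<lambda>(i, j). a i j)) I I) * y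
    = y * Pf (submatrix (mat n n (\<lambda>(i, j). a i j)) I I)"
proof -
  have "of_int s * P * y = y * (of_int s * P)" if "P * y = y * P" for s and P :: 'a
    using that by (metis mult.assoc mult_of_int_commute)
  then have "of_int s * prod_list (map (\<lambda>l. a (h (2 * l)) (h (2 * l + 1))) [0..<k]) * y
      = y * (of_int s * prod_list (map (\<lambda>l. a (h (2 * l)) (h (2 * l + 1))) [0..<k]))" for s h
    by (rule, intro prod_list_commute) (auto simp: y)
  from this[of _ "pick I \<circ> _"] show ?thesis
    unfolding Pf_submatrix[OF I] by (simp add: sum_distrib_left sum_distrib_right)
qed

text \<open>Every term has k factors. For the block of the derivatives this sign will cancel the one
  in \<open>ordered_prod_triple\<close>.\<close>

lemma Pf_submatrix_uminus:
  assumes I: "I \<subseteq> {0..<n}" "card I = 2 * k"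
  shows "Pf (submatrix (mat n n (\<lambda>(i, j). - a i j)) I I)
    = (- 1) ^ k * Pf (submatrix (mat n n (\<lambda>(i, j). a i j)) I I)"
proof -
  have "prod_list (map (\<lambda>x. - g x) xs) = (- 1) ^ length xs * prod_list (map g xs)"
    for g :: "nat \<Rightarrow> 'a" and xs
    by (induction xs) (auto simp: mult.assoc minus_one_power_iff)
  then have neg: "prod_list (map (\<lambda>x. - g x) [0..<k]) = (- 1) ^ k * prod_list (map g [0..<k])"
    for g :: "nat \<Rightarrow> 'a"
    by simp
  show ?thesis
    unfolding Pf_submatrix[OF I]
    by (cases "even k") (simp_all add: neg sum_negf)
qed

section \<open>Paired generators\<close>

text \<open>Two sign changes cancel. All commutation properties of quadratic monomials come from
  this.\<close>

lemma anticommuting_pair_commute: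
  assumes "anticommuting f"
  shows "f i * f j * f k = f k * (f i * f j)"
proof -
  have "f i * f j * f k = - (f i * f k * f j)"
    using anticommutingD[OF assms, of j k] by (simp add: mult.assoc)
  also have "\<dots> = f k * (f i * f j)"
    using anticommutingD[OF assms, of i k] by (simp add: mult.assoc)
  finally show ?thesis .
qed

text \<open>Lets a whole matrix count as one of its minors, so that \<open>Pf_power\<close> also
  yields the full Pfaffian.\<close>

lemma submatrix_full: "submatrix (mat N N g) {0..<N} {0..<N} = mat N N g"
proof -
  have "map (pick {0..<N}) [0..<N] = [0..<N]"
    using pick_upt_eq_sorted_list[of "{0..<N}"] by simp
  then have "pick {0..<N} i = i" if "i < N" for i
    using that by (metis add_0 diff_zero length_upt nth_map nth_upt)
  then show ?thesis
    by (intro eq_matI) (auto simp: dim_submatrix submatrix_index)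
qed

lemma sum_lessThan_double:
  fixes g :: "nat \<Rightarrow> 'a::comm_monoid_add"
  shows "(\<Sum>a\<in>{0..<2 * n}. g a) = (\<Sum>i\<in>{0..<n}. g i + g (2 * n - 1 - i))"
proof -
  have "(\<Sum>a\<in>{0..<2 * n}. g a) = (\<Sum>a\<in>{0..<n}. g a) + (\<Sum>a\<in>{n..<2 * n}. g a)"
    by (simp add: sum.atLeastLessThan_concat)
  also have "(\<Sum>a\<in>{n..<2 * n}. g a) = (\<Sum>i\<in>{0..<n}. g (2 * n - 1 - i))"
    by (rule sum.reindex_bij_witness[where i = "\<lambda>i. 2 * n - 1 - i" and j = "\<lambda>i. 2 * n - 1 - i"]) auto
  finally show ?thesis
    by (simp add: sum.distrib)
qed

text \<open>The partner of index \<open>i\<close> is \<open>2n - 1 - i\<close>: indices start at \<open>0\<close>, and no element outside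
  \<open>i < n\<close> is ever paired, so the truncated subtraction is harmless.\<close>

locale anticommuting_pairs =
  fixes f :: "nat \<Rightarrow> 'a::real_algebra_1" and n :: nat
  assumes anti: "anticommuting f"
begin

definition f' :: "nat \<Rightarrow> 'a" where
  "f' i = f (2 * n - 1 - i)"

definition z :: "nat \<Rightarrow> 'a" where
  "z i = f i * f' i"

lemma anti': "anticommuting f'"
  using anticommutingD[OF anti] unfolding anticommuting_def f'_def by blast

lemma z_f: "z i * f j = f j * z i" and z_f': "z i * f' j = f' j * z i"
  unfolding z_def f'_def by (rule anticommuting_pair_commute[OF anti])+

lemma z_z: "z i * z j = z j * z i"
  unfolding z_def[of j] by (metis mult.assoc z_f z_f')

lemma f_z_0: "f i * z i = 0" and f'_z_0: "f' i * z i = 0" and z_z_0: "z i * z i = 0"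
proof -
  show fz: "f i * z i = 0"
    by (simp add: z_def anticommuting_square[OF anti] flip: mult.assoc)
  show "f' i * z i = 0"
    using z_f'[of i i] by (simp add: z_def anticommuting_square[OF anti'] mult.assoc)
  have "z i * z i = z i * f i * f' i"
    by (simp only: z_def mult.assoc)
  also have "\<dots> = 0"
    by (simp only: z_f fz mult_zero_left)
  finally show "z i * z i = 0" .
qed

text \<open>Each partner moves left across the generators that follow its own one; the crossings
  number 0 + 1 + ... + (m - 1), where m is the length of the list.\<close>

lemma prod_f_f': "prod_list (map f xs) * prod_list (map f' xs)
    = (- 1) ^ (length xs choose 2) * prod_list (map z xs)"
proof (induction xs)
  case (Cons x xs)
  let ?F = "prod_list (map f xs)" and ?F' = "prod_list (map f' xs)"
  have "?F * f' x = (- 1) ^ length xs * (f' x * ?F)"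
    using anticommuting_move[OF anti, of "2 * n - 1 - x" xs]
    by (cases "even (length xs)") (simp_all add: f'_def)
  then have "f x * (?F * f' x) * ?F' = (- 1) ^ length xs * (z x * (?F * ?F'))"
    by (cases "even (length xs)") (simp_all add: z_def mult.assoc)
  also have "\<dots> = (- 1) ^ length xs * (- 1) ^ (length xs choose 2) * (z x * prod_list (map z xs))"
    unfolding Cons.IH by (cases "even (length xs choose 2)") simp_all
  finally show ?case
    by (simp add: numeral_2_eq_2 power_add mult.assoc)
qed (simp add: numeral_2_eq_2)

text \<open>With the partners reversed the innermost pair is adjacent and commutes outwards, so no
  sign arises.\<close>

lemma prod_f_f'_rev:
  "prod_list (map f xs) * prod_list (map f' (rev xs)) = prod_list (map z xs)"
proof (induction xs)
  case (Cons x xs)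
  have "prod_list (map f (x # xs)) * prod_list (map f' (rev (x # xs)))
      = f x * (prod_list (map f xs) * prod_list (map f' (rev xs))) * f' x"
    by (simp add: mult.assoc)
  also have "\<dots> = f x * (prod_list (map z xs) * f' x)"
    unfolding Cons.IH by (simp add: mult.assoc)
  also have "prod_list (map z xs) * f' x = f' x * prod_list (map z xs)"
    by (intro prod_list_commute) (auto simp: z_f')
  finally show ?case
    by (simp add: z_def[of x] mult.assoc)
qed simp

text \<open>The upper half of the indices in increasing order is the sequence of partners in
  decreasing order, so the top monomial is the product of all \<open>z i\<close> with sign
  +1.\<close>

lemma ordered_prod_double: "ordered_prod f {0..<2 * n} = ordered_prod z {0..<n}"
proof -
  have "map f [n..<2 * n] = map f' (rev [0..<n])"
    by (intro nth_equalityI) (auto simp: f'_def rev_nth)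
  moreover have "[0..<2 * n] = [0..<n] @ [n..<2 * n]"
    using upt_add_eq_append[of 0 n n] by (simp add: mult_2)
  ultimately show ?thesis
    by (simp add: ordered_prod_def prod_f_f'_rev flip: map_append)
       (simp add: prod_f_f'_rev)
qed

lemma ordered_prod_factor_0:
  assumes "\<And>j. g j * y = y * g j" "g i * y = 0" "finite I" "i \<in> I"
  shows "ordered_prod g I * (y :: 'a) = 0"
proof -
  obtain us vs where *: "sorted_list_of_set I = us @ i # vs"
    using assms(3,4) by (metis set_sorted_list_of_set split_list)
  have "prod_list (map g vs) * y = y * prod_list (map g vs)"
    by (intro prod_list_commute) (auto simp: assms)
  then have "ordered_prod g I * y = prod_list (map g us) * ((g i * y) * prod_list (map g vs))"
    by (simp add: ordered_prod_def * mult.assoc)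
  then show ?thesis using assms(2) by simp
qed

lemma ordered_prod_split_factor:
  assumes "finite K" "i \<in> K"
  shows "\<exists>y. ordered_prod z K = z i * y"
proof -
  obtain us vs where *: "sorted_list_of_set K = us @ i # vs"
    using assms by (metis set_sorted_list_of_set split_list)
  have "ordered_prod z K = prod_list (map z (i # us @ vs))"
    unfolding ordered_prod_def * by (intro prod_list_commuting_perm z_z) simp
  then show ?thesis by auto
qed

text \<open>The product has degree 2n in 2n generators. It vanishes if a generator is repeated, and
  otherwise the cardinalities force I = J to be the complement of K.\<close>

lemma ordered_prod_triple:
  assumes sub: "I \<subseteq> {0..<n}" "J \<subseteq> {0..<n}" "K \<subseteq> {0..<n}"
    and card: "card I = 2 * k" "card I + card J + 2 * card K = 2 * n"
  shows "ordered_prod f I * ordered_prod f' J * ordered_prod z K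
    = (if J = I \<and> K = {0..<n} - I then (- 1) ^ k * ordered_prod f {0..<2 * n} else 0)"
proof (cases "I \<inter> K = {} \<and> J \<inter> K = {}")
  case False
  have fin: "finite I" "finite J" "finite K"
    using sub finite_subset by blast+
  have comm: "ordered_prod f' J * z i = z i * ordered_prod f' J" for i
    by (intro ordered_prod_commute) (use fin z_f' in auto)
  from False obtain i where i: "i \<in> K" "i \<in> I \<or> i \<in> J" by blast
  obtain y where y: "ordered_prod z K = z i * y"
    using ordered_prod_split_factor[OF fin(3) i(1)] by blast
  \<comment> \<open>The factor \<open>z i\<close> contains both \<open>f i\<close> and its partner,
    so it is killed by either of the first two monomials as soon as i lies in I or J.\<close>
  have "ordered_prod f I * ordered_prod f' J * z i = 0"
  proof (cases "i \<in> I")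
    case True
    then have "ordered_prod f I * z i = 0"
      by (intro ordered_prod_factor_0[where i = i]) (use fin z_f f_z_0 in auto)
    then show ?thesis
      by (simp add: mult.assoc comm) (simp flip: mult.assoc)
  next
    case False
    then have "ordered_prod f' J * z i = 0"
      using i by (intro ordered_prod_factor_0[where i = i]) (use fin z_f' f'_z_0 in auto)
    then show ?thesis
      by (simp add: mult.assoc)
  qed
  then have "ordered_prod f I * ordered_prod f' J * ordered_prod z K = 0"
    by (simp add: y flip: mult.assoc)
  then show ?thesis using False by auto
next
  case True
  have fin: "finite I" "finite J" "finite K"
    using sub finite_subset by blast+
  \<comment> \<open>Both cardinalities are at most n and their sum is 2n, so both equal n.\<close>
  have "card I + card K \<le> n" "card J + card K \<le> n"
    using True sub fin card_mono[of "{0..<n}" "I \<union> K"] card_mono[of "{0..<n}" "J \<union> K"]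
    by (simp_all add: card_Un_disjoint)
  with card have "card I + card K = n" "card J + card K = n"
    by simp_all
  then have "I \<union> K = {0..<n}" "J \<union> K = {0..<n}"
    using True sub fin by (intro card_subset_eq; simp add: card_Un_disjoint)+
  then have J: "J = I" and K: "K = {0..<n} - I"
    using True by blast+
  \<comment> \<open>The binomial coefficient is k(2k - 1), which has the parity of k.\<close>
  have "even (2 * k choose 2) = even k"
    by (cases k) (simp_all add: choose_two)
  then have sgn: "(- 1 :: 'a) ^ (2 * k choose 2) = (- 1) ^ k"
    by (simp add: minus_one_power_iff)
  have "ordered_prod f I * ordered_prod f' I * ordered_prod z K
      = (- 1) ^ k * prod_list (map z (sorted_list_of_set I @ sorted_list_of_set K))"
    using fin card(1) by (simp add: ordered_prod_def prod_f_f' sgn mult.assoc)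
  also have "prod_list (map z (sorted_list_of_set I @ sorted_list_of_set K)) = ordered_prod z {0..<n}"
    unfolding ordered_prod_def
  proof (rule prod_list_commuting_perm[OF z_z])
    show "mset (sorted_list_of_set I @ sorted_list_of_set K) = mset (sorted_list_of_set {0..<n})"
      using fin sub(1) unfolding K
      by (intro set_eq_iff_mset_eq_distinct[THEN iffD1]) auto
  qed
  finally show ?thesis
    using J K by (simp add: ordered_prod_double)
qed

end

section \<open>The Pfaffian over a Weyl algebra\<close>

lemma commute_mult:
  fixes y :: "'a::semigroup_mult"
  assumes "a * y = y * a" "b * y = y * b"
  shows "a * b * y = y * (a * b)"
proof -
  have "a * b * y = a * y * b"
    by (simp only: assms(2) mult.assoc)
  then show ?thesis
    by (simp only: assms(1) mult.assoc)
qed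

text \<open>Coefficients and generators live in one algebra and commute with each other. The second
  delta in \<open>weyl\<close> reflects that the coordinates alternate in their indices. U stands
  for the scalar u, and \<open>\<alpha>\<close> for the values a_m(u), given only through their
  recurrence.\<close>

locale weyl_pairs = anticommuting_pairs +
  fixes x d :: "nat \<Rightarrow> nat \<Rightarrow> 'a" and U :: 'a and \<alpha> :: "nat \<Rightarrow> 'a"
  assumes x_f: "x i j * f k = f k * x i j" and d_f: "d i j * f k = f k * d i j"
    and weyl: "d k l * x i j = x i j * d k l + (of_bool (k = i \<and> l = j) - of_bool (k = j \<and> l = i))"
    and U_f: "U * f k = f k * U" and U_x: "U * x i j = x i j * U" and U_d: "U * d i j = d i j * U"
    and \<alpha>_f: "\<alpha> m * f k = f k * \<alpha> m"
    and \<alpha>_0: "\<alpha> 0 = 1"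
    and \<alpha>_Suc: "\<alpha> (Suc m) = U * \<alpha> m + (if m = 0 then 0 else (real m / 2) *\<^sub>R \<alpha> (m - 1))"
begin

definition X :: 'a where
  "X = (1 / 2) *\<^sub>R (\<Sum>i\<in>{0..<n}. \<Sum>j\<in>{0..<n}. x i j * (f i * f j))"

text \<open>At the positions of the partners of i and j the lower right block -JDJ has entry
  \<open>- d i j\<close>, whence the sign.\<close>

definition Y :: 'a where
  "Y = (1 / 2) *\<^sub>R (\<Sum>i\<in>{0..<n}. \<Sum>j\<in>{0..<n}. - d i j * (f' i * f' j))"

definition Z :: 'a where
  "Z = (\<Sum>i\<in>{0..<n}. z i)"

lemma Z_commute: "(\<And>k. y * f k = f k * y) \<Longrightarrow> y * Z = Z * y"
  unfolding Z_def z_def f'_def sum_distrib_left sum_distrib_right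
  by (intro sum.cong refl commute_mult[symmetric]) simp_all

lemma Z_f: "Z * f k = f k * Z" and Z_f': "Z * f' k = f' k * Z"
  by (simp_all add: Z_def sum_distrib_left sum_distrib_right z_f z_f')

lemma Z_X: "Z * X = X * Z" and Z_Y: "Z * Y = Y * Z"
proof -
  have "x i j * (f i * f j) * Z = Z * (x i j * (f i * f j))" for i j
    using Z_commute[of "x i j", OF x_f] by (intro commute_mult) (simp_all only: Z_f)
  moreover have "- d i j * (f' i * f' j) * Z = Z * (- d i j * (f' i * f' j))" for i j
    using Z_commute[of "d i j", OF d_f] by (intro commute_mult) (simp_all add: Z_f')
  ultimately show "Z * X = X * Z" "Z * Y = Y * Z"
    by (simp_all add: X_def Y_def sum_distrib_left sum_distrib_right del: mult_minus_left mult_minus_right)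
qed

lemma U_X: "U * X = X * U" and U_Y: "U * Y = Y * U"
proof -
  have "x i j * (f i * f j) * U = U * (x i j * (f i * f j))" for i j
    by (intro commute_mult) (simp_all only: U_x U_f)
  moreover have "- d i j * (f' i * f' j) * U = U * (- d i j * (f' i * f' j))" for i j
    by (intro commute_mult) (simp_all add: f'_def U_d U_f)
  ultimately show "U * X = X * U" "U * Y = Y * U"
    by (simp_all add: X_def Y_def sum_distrib_left sum_distrib_right del: mult_minus_left mult_minus_right)
qed

text \<open>The pair (k, l) of the derivative can be contracted with (i, j) in two ways. After
  reordering the generators each contributes \<open>z i * z j\<close>, and the two factors 1/2 of X
  and Y leave 1/2.\<close>

lemma Y_X: "Y * X = X * Y + (1 / 2) *\<^sub>R (Z * Z)"
proof -
  let ?S = "{0..<n}"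
  let ?q = "\<lambda>k l i j. f' k * f' l * (f i * f j)"
  have comm: "f i * f j * (f' k * f' l) = ?q k l i j" for i j k l
    unfolding f'_def by (intro commute_mult anticommuting_pair_commute[OF anti, symmetric])
  have d: "f i * f j * d k l = d k l * (f i * f j)"
    and x: "f' i * f' j * x k l = x k l * (f' i * f' j)" for i j k l
    unfolding f'_def by (intro commute_mult; simp only: d_f x_f)+
  \<comment> \<open>Quadratic monomials in the generators commute with everything here, so only the
    commutator of the coefficients remains.\<close>
  have summand: "- d k l * (f' k * f' l) * (x i j * (f i * f j)) - x i j * (f i * f j) * (- d k l * (f' k * f' l))
      = (if k = j then if l = i then ?q k l i j else 0 else 0)
      - (if k = i then if l = j then ?q k l i j else 0 else 0)" for i j k l
  proof -
    have "d k l * (f' k * f' l) * (x i j * (f i * f j)) = d k l * x i j * ?q k l i j"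
    proof -
      have "d k l * (f' k * f' l) * (x i j * (f i * f j)) = d k l * (f' k * f' l * x i j) * (f i * f j)"
        by (simp only: mult.assoc)
      then show ?thesis
        unfolding x by (simp only: mult.assoc)
    qed
    moreover have "x i j * (f i * f j) * (d k l * (f' k * f' l)) = x i j * d k l * ?q k l i j"
    proof -
      have "x i j * (f i * f j) * (d k l * (f' k * f' l)) = x i j * (f i * f j * d k l) * (f' k * f' l)"
        by (simp only: mult.assoc)
      then show ?thesis
        unfolding d comm[symmetric] by (simp only: mult.assoc)
    qed
    ultimately have "- d k l * (f' k * f' l) * (x i j * (f i * f j)) - x i j * (f i * f j) * (- d k l * (f' k * f' l))
       = - ((d k l * x i j - x i j * d k l) * ?q k l i j)"
      by (simp add: left_diff_distrib)
    also have "d k l * x i j - x i j * d k l = of_bool (k = i \<and> l = j) - of_bool (k = j \<and> l = i)"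
      by (simp add: weyl)
    finally show ?thesis
      by (auto simp: left_diff_distrib)
  qed
  have q: "?q j i i j - ?q i j i j = 2 *\<^sub>R (z i * z j)" for i j
  proof -
    have "?q j i i j = - ?q i j i j"
      using anticommutingD[OF anti', of j i] by simp
    moreover have "?q i j i j = - (z i * z j)"
    proof -
      have fz: "f i * f j * f' i = f' i * (f i * f j)" for i j
        unfolding f'_def by (rule anticommuting_pair_commute[OF anti])
      have "?q i j i j = f i * f j * (f' i * f' j)"
        by (simp add: comm)
      also have "\<dots> = f i * (f j * f' i) * f' j"
        by (simp add: mult.assoc)
      also have "f j * f' i = - (f' i * f j)"
        unfolding f'_def by (rule anticommutingD[OF anti])
      finally show ?thesis
        by (simp add: z_def mult.assoc)
    qed
    ultimately show ?thesis
      by (simp add: scaleR_2)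
  qed
  let ?T = "\<lambda>k l. - d k l * (f' k * f' l)" and ?R = "\<lambda>i j. x i j * (f i * f j)"
  have "4 *\<^sub>R (Y * X - X * Y)
      = (\<Sum>k\<in>?S. \<Sum>l\<in>?S. ?T k l) * (\<Sum>i\<in>?S. \<Sum>j\<in>?S. ?R i j)
      - (\<Sum>i\<in>?S. \<Sum>j\<in>?S. ?R i j) * (\<Sum>k\<in>?S. \<Sum>l\<in>?S. ?T k l)"
    unfolding X_def Y_def by (simp only: mult_scaleR_left mult_scaleR_right scaleR_scaleR scaleR_diff_right) simp
  also have "(\<Sum>k\<in>?S. \<Sum>l\<in>?S. ?T k l) * (\<Sum>i\<in>?S. \<Sum>j\<in>?S. ?R i j)
      = (\<Sum>i\<in>?S. \<Sum>j\<in>?S. \<Sum>k\<in>?S. \<Sum>l\<in>?S. ?T k l * ?R i j)"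
    by (simp only: sum_distrib_left sum_distrib_right)
  also have "(\<Sum>i\<in>?S. \<Sum>j\<in>?S. ?R i j) * (\<Sum>k\<in>?S. \<Sum>l\<in>?S. ?T k l)
      = (\<Sum>i\<in>?S. \<Sum>j\<in>?S. \<Sum>k\<in>?S. \<Sum>l\<in>?S. ?R i j * ?T k l)"
    unfolding sum_distrib_right by (simp only: sum_distrib_left)
  also have "(\<Sum>i\<in>?S. \<Sum>j\<in>?S. \<Sum>k\<in>?S. \<Sum>l\<in>?S. ?T k l * ?R i j)
      - (\<Sum>i\<in>?S. \<Sum>j\<in>?S. \<Sum>k\<in>?S. \<Sum>l\<in>?S. ?R i j * ?T k l)
      = (\<Sum>i\<in>?S. \<Sum>j\<in>?S. \<Sum>k\<in>?S. \<Sum>l\<in>?S. ?T k l * ?R i j - ?R i j * ?T k l)"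
    by (simp only: sum_subtractf)
  also have "\<dots> = (\<Sum>i\<in>?S. \<Sum>j\<in>?S. ?q j i i j - ?q i j i j)"
  proof (intro sum.cong refl)
    fix i j assume "i \<in> ?S" "j \<in> ?S"
    \<comment> \<open>Pulls the condition on k out of the sum over l, so that the two deltas can be
      evaluated one after the other.\<close>
    moreover have "(\<Sum>l\<in>?S. if P then h l else 0) = (if P then \<Sum>l\<in>?S. h l else 0)" for P and h :: "nat \<Rightarrow> 'a"
      by simp
    ultimately show "(\<Sum>k\<in>?S. \<Sum>l\<in>?S. ?T k l * ?R i j - ?R i j * ?T k l) = ?q j i i j - ?q i j i j"
      by (simp only: summand sum_subtractf sum.delta finite_atLeastLessThan if_True)
  qed
  also have "\<dots> = 2 *\<^sub>R (Z * Z)"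
    by (simp only: q Z_def sum_product scaleR_sum_right)
  finally have "4 *\<^sub>R (Y * X - X * Y) = 4 *\<^sub>R ((1 / 2) *\<^sub>R (Z * Z))"
    by simp
  then have "Y * X - X * Y = (1 / 2) *\<^sub>R (Z * Z)"
    by (rule scaleR_left_imp_eq[rotated]) simp
  then show ?thesis
    by (simp add: diff_eq_eq add.commute)
qed

section \<open>The normally ordered expansion and its top degree\<close>

text \<open>Here C = UZ, W = Z^2/2 and g m = \<open>\<alpha> m\<close> Z^m / m!; the recurrence of
  \<open>\<alpha>\<close> is what makes g satisfy the one required.\<close>

lemma power_sum:
  "(X + Y + U * Z) ^ n /\<^sub>R fact n = (\<Sum>i=0..n. X ^ i /\<^sub>R fact i *
    (\<Sum>j=0..n-i. Y ^ j /\<^sub>R fact j * (\<alpha> (n - i - j) * (Z ^ (n - i - j) /\<^sub>R fact (n - i - j)))))"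
proof (rule power_sum_normal_ordering[OF Y_X])
  let ?g = "\<lambda>m. \<alpha> m * (Z ^ m /\<^sub>R fact m)"
  have \<alpha>_Z: "Z * \<alpha> m = \<alpha> m * Z" for m
    using Z_commute[of "\<alpha> m", OF \<alpha>_f] by simp
  fix m
  have fact: "real (Suc m) * inverse (fact (Suc m)) = inverse (fact m)"
    by (simp add: field_simps del: of_nat_Suc)
  have "real (Suc m) *\<^sub>R ?g (Suc m) = (real (Suc m) * inverse (fact (Suc m))) *\<^sub>R (\<alpha> (Suc m) * Z ^ Suc m)"
    by (simp only: mult_scaleR_right scaleR_scaleR)
  also have "\<dots> = U * (\<alpha> m * Z) * Z ^ m /\<^sub>R fact m
      + (if m = 0 then 0 else (real m / 2) *\<^sub>R (\<alpha> (m - 1) * Z ^ Suc m) /\<^sub>R fact m)"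
    unfolding fact \<alpha>_Suc by (simp add: distrib_right scaleR_add_right mult.assoc)
  also have "U * (\<alpha> m * Z) * Z ^ m /\<^sub>R fact m = U * Z * ?g m"
    by (simp add: mult.assoc flip: \<alpha>_Z)
  also have "(if m = 0 then 0 else (real m / 2) *\<^sub>R (\<alpha> (m - 1) * Z ^ Suc m) /\<^sub>R fact m)
      = (if m = 0 then 0 else (1 / 2) *\<^sub>R (Z * Z) * ?g (m - 1))"
  proof (cases m)
    case (Suc k)
    have "Z * Z * (\<alpha> k * Z ^ k) = \<alpha> k * Z ^ Suc (Suc k)"
    proof -
      have "Z * (\<alpha> k * y) = \<alpha> k * (Z * y)" for y
        by (simp only: \<alpha>_Z flip: mult.assoc)
      then show ?thesis by (simp add: mult.assoc)
    qed
    moreover have "inverse (fact (Suc k)) * (real (Suc k) / 2) = inverse (fact k) / 2"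
      by (simp add: field_simps del: of_nat_Suc)
    ultimately show ?thesis
      using Suc by (simp del: of_nat_Suc fact_Suc power_Suc)
  qed simp
  finally show "real (Suc m) *\<^sub>R ?g (Suc m)
      = U * Z * ?g m + (if m = 0 then 0 else (1 / 2) *\<^sub>R (Z * Z) * ?g (m - 1))" .
next
  have "Z * Z * y = y * (Z * Z)" "U * Z * y = y * (U * Z)" if "Z * y = y * Z" "U * y = y * U" for y
    using that by (auto intro!: commute_mult)
  from this[OF Z_X U_X] this[OF Z_Y U_Y]
  show "(1 / 2) *\<^sub>R (Z * Z) * X = X * ((1 / 2) *\<^sub>R (Z * Z))"
    "(1 / 2) *\<^sub>R (Z * Z) * Y = Y * ((1 / 2) *\<^sub>R (Z * Z))"
    "U * Z * X = X * (U * Z)" "U * Z * Y = Y * (U * Z)"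
    by simp_all
qed (simp add: \<alpha>_0)

lemma Pf_power_X: "X ^ k /\<^sub>R fact k = (\<Sum>I | I \<subseteq> {0..<n} \<and> card I = 2 * k.
    Pf (submatrix (mat n n (\<lambda>(i, j). x i j)) I I) * ordered_prod f I)"
  unfolding X_def by (rule Pf_power[OF anti x_f])

lemma Pf_power_Y: "Y ^ k /\<^sub>R fact k = (\<Sum>J | J \<subseteq> {0..<n} \<and> card J = 2 * k.
    Pf (submatrix (mat n n (\<lambda>(i, j). - d i j)) J J) * ordered_prod f' J)"
  unfolding Y_def by (rule Pf_power[OF anti']) (simp add: d_f f'_def)

lemma Z_power: "Z ^ m /\<^sub>R fact m = (\<Sum>K | K \<subseteq> {0..<n} \<and> card K = m. ordered_prod z K)"
  unfolding Z_def by (rule sum_power_commuting) (simp_all add: z_z z_z_0)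

abbreviation "Pfx I \<equiv> Pf (submatrix (mat n n (\<lambda>(i, j). x i j)) I I)"
abbreviation "Pfd I \<equiv> Pf (submatrix (mat n n (\<lambda>(i, j). d i j)) I I)"

text \<open>The three powers expand into monomials over I, J and K of total degree 2n, so
  \<open>ordered_prod_triple\<close> leaves only J = I with K its complement.\<close>

lemma normal_ordered_term:
  assumes "i + j \<le> n"
  shows "X ^ i /\<^sub>R fact i * (Y ^ j /\<^sub>R fact j * (\<alpha> (n - i - j) * (Z ^ (n - i - j) /\<^sub>R fact (n - i - j))))
    = (if i = j then (\<Sum>I | I \<subseteq> {0..<n} \<and> card I = 2 * i. Pfx I * Pfd I) * \<alpha> (n - 2 * i)
        * ordered_prod f {0..<2 * n} else 0)"
proof -
  let ?m = "n - i - j" and ?top = "ordered_prod f {0..<2 * n}"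
  let ?N = "\<lambda>J. Pf (submatrix (mat n n (\<lambda>(i, j). - d i j)) J J)"
  let ?Is = "{I. I \<subseteq> {0..<n} \<and> card I = 2 * i}" and ?Js = "{J. J \<subseteq> {0..<n} \<and> card J = 2 * j}"
    and ?Ks = "{K. K \<subseteq> {0..<n} \<and> card K = ?m}"
  have fin: "finite ?Is" "finite ?Js" "finite ?Ks"
    by auto
  have summand: "Pfx I * ordered_prod f I * (?N J * ordered_prod f' J * (\<alpha> ?m * ordered_prod z K))
      = (if J = I then if K = {0..<n} - I then Pfx I * Pfd I * \<alpha> ?m * ?top else 0 else 0)"
    if I: "I \<in> ?Is" and J: "J \<in> ?Js" and K: "K \<in> ?Ks" for I J K
  proof -
    have finI: "finite I" "finite J"
      using I J finite_subset by blast+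
    have N: "ordered_prod f I * ?N J = ?N J * ordered_prod f I"
      using J by (intro ordered_prod_commute finI Pf_submatrix_commute[symmetric]) (auto simp: d_f)
    have \<alpha>: "ordered_prod f' J * \<alpha> ?m = \<alpha> ?m * ordered_prod f' J" "ordered_prod f I * \<alpha> ?m = \<alpha> ?m * ordered_prod f I"
      by (intro ordered_prod_commute finI; simp add: f'_def \<alpha>_f)+
    have "Pfx I * ordered_prod f I * (?N J * ordered_prod f' J * (\<alpha> ?m * ordered_prod z K))
        = Pfx I * (ordered_prod f I * ?N J) * (ordered_prod f' J * \<alpha> ?m) * ordered_prod z K"
      by (simp only: mult.assoc)
    also have "\<dots> = Pfx I * ?N J * (ordered_prod f I * \<alpha> ?m) * ordered_prod f' J * ordered_prod z K"
      by (simp only: N \<alpha>(1) mult.assoc)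
    also have "\<dots> = Pfx I * ?N J * \<alpha> ?m * (ordered_prod f I * ordered_prod f' J * ordered_prod z K)"
      by (simp only: \<alpha>(2) mult.assoc)
    also have "ordered_prod f I * ordered_prod f' J * ordered_prod z K
        = (if J = I \<and> K = {0..<n} - I then (- 1) ^ i * ?top else 0)"
      using I J K assms by (intro ordered_prod_triple) auto
    also have "Pfx I * ?N J * \<alpha> ?m * \<dots>
        = (if J = I then if K = {0..<n} - I then Pfx I * ((- 1) ^ i * ?N I) * \<alpha> ?m * ?top else 0 else 0)"
      by (cases "even i") (auto simp: mult.assoc)
    \<comment> \<open>The sign from pairing the generators with their partners is undone by the
      minus signs in front of the derivatives.\<close>
    also have "(- 1) ^ i * ?N I = Pfd I"
      using I by (subst Pf_submatrix_uminus[of I n i]) (auto simp flip: mult.assoc power_add)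
    finally show ?thesis .
  qed
  have "X ^ i /\<^sub>R fact i * (Y ^ j /\<^sub>R fact j * (\<alpha> ?m * (Z ^ ?m /\<^sub>R fact ?m)))
      = (\<Sum>I\<in>?Is. \<Sum>J\<in>?Js. \<Sum>K\<in>?Ks. Pfx I * ordered_prod f I * (?N J * ordered_prod f' J * (\<alpha> ?m * ordered_prod z K)))"
    unfolding Pf_power_X Pf_power_Y Z_power sum_distrib_right
    by (simp only: sum_distrib_left)
  also have "\<dots> = (\<Sum>I\<in>?Is. \<Sum>J\<in>?Js. \<Sum>K\<in>?Ks.
      if J = I then if K = {0..<n} - I then Pfx I * Pfd I * \<alpha> ?m * ?top else 0 else 0)"
    by (intro sum.cong refl summand)
  also have "\<dots> = (\<Sum>I\<in>?Is. \<Sum>J\<in>?Js. if J = I then Pfx I * Pfd I * \<alpha> ?m * ?top else 0)"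
  proof (intro sum.cong refl)
    fix I J assume IJ: "I \<in> ?Is" "J \<in> ?Js"
    show "(\<Sum>K\<in>?Ks. if J = I then if K = {0..<n} - I then Pfx I * Pfd I * \<alpha> ?m * ?top else 0 else 0)
        = (if J = I then Pfx I * Pfd I * \<alpha> ?m * ?top else 0)"
    proof (cases "J = I")
      case True
      \<comment> \<open>From J = I follows i = j, so the complement of I has the n - i - j elements
        required of K.\<close>
      with IJ have "{0..<n} - I \<in> ?Ks"
        by (auto simp: card_Diff_subset finite_subset)
      then show ?thesis
        by (simp only: True simp_thms if_True sum.delta[OF fin(3)])
    qed simp
  qed
  also have "\<dots> = (\<Sum>I\<in>?Is. if I \<in> ?Js then Pfx I * Pfd I * \<alpha> ?m * ?top else 0)"
    by (simp only: sum.delta[OF fin(2)])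
  also have "\<dots> = (if i = j then (\<Sum>I\<in>?Is. Pfx I * Pfd I) * \<alpha> (n - 2 * i) * ?top else 0)"
  proof (cases "i = j")
    case True
    then have "?m = n - 2 * i" by simp
    with True show ?thesis
      by (simp add: sum_distrib_right)
  qed (simp add: sum.neutral)
  finally show ?thesis .
qed

lemma power_sum_Pf:
  "(X + Y + U * Z) ^ n /\<^sub>R fact n = (\<Sum>k=0..n div 2.
    (\<Sum>I | I \<subseteq> {0..<n} \<and> card I = 2 * k. Pfx I * Pfd I) * \<alpha> (n - 2 * k)) * ordered_prod f {0..<2 * n}"
proof -
  let ?T = "\<lambda>i. (\<Sum>I | I \<subseteq> {0..<n} \<and> card I = 2 * i. Pfx I * Pfd I) * \<alpha> (n - 2 * i) * ordered_prod f {0..<2 * n}"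
  have "(X + Y + U * Z) ^ n /\<^sub>R fact n = (\<Sum>i=0..n. \<Sum>j=0..n-i. if i = j then ?T i else 0)"
    unfolding power_sum sum_distrib_left
    by (intro sum.cong refl normal_ordered_term) auto
  \<comment> \<open>The diagonal index j = i lies in the inner range exactly when 2i is at most
    n.\<close>
  also have "\<dots> = (\<Sum>i=0..n. if i \<le> n - i then ?T i else 0)"
    by (intro sum.cong refl) (simp add: sum.delta')
  also have "\<dots> = (\<Sum>i=0..n div 2. ?T i)"
    by (rule sum.mono_neutral_cong_right) auto
  finally show ?thesis
    by (simp add: sum_distrib_right)
qed

text \<open>The full index set is the only subset of size 2n, so the n-th divided power of the
  quadratic element is the Pfaffian times the top monomial. Splitting that element into blocks gives
  X + Y + UZ.\<close>

theorem Pf_block: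
  assumes \<phi>: "\<And>i j. i < n \<Longrightarrow> j < n \<Longrightarrow> \<phi> i j = x i j"
    "\<And>i j. i < n \<Longrightarrow> j < n \<Longrightarrow> \<phi> i (2 * n - 1 - j) = (if i = j then U else 0)"
    "\<And>i j. i < n \<Longrightarrow> j < n \<Longrightarrow> \<phi> (2 * n - 1 - i) j = (if i = j then - U else 0)"
    "\<And>i j. i < n \<Longrightarrow> j < n \<Longrightarrow> \<phi> (2 * n - 1 - i) (2 * n - 1 - j) = - d i j"
    and \<phi>_f: "\<And>a b k. \<phi> a b * f k = f k * \<phi> a b"
  shows "Pf (mat (2 * n) (2 * n) (\<lambda>(a, b). \<phi> a b)) * ordered_prod f {0..<2 * n}
    = (\<Sum>k=0..n div 2. (\<Sum>I | I \<subseteq> {0..<n} \<and> card I = 2 * k. Pfx I * Pfd I) * \<alpha> (n - 2 * k))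
      * ordered_prod f {0..<2 * n}"
proof -
  let ?S = "{0..<n}" and ?h = "\<lambda>a b. \<phi> a b * (f a * f b)"
  have "{I. I \<subseteq> {0..<2 * n} \<and> card I = 2 * n} = {{0..<2 * n}}"
    using card_subset_eq[of "{0..<2 * n}"] by auto
  then have "Pf (mat (2 * n) (2 * n) (\<lambda>(a, b). \<phi> a b)) * ordered_prod f {0..<2 * n}
      = ((1 / 2) *\<^sub>R (\<Sum>a\<in>{0..<2 * n}. \<Sum>b\<in>{0..<2 * n}. ?h a b)) ^ n /\<^sub>R fact n"
    by (simp add: Pf_power[OF anti \<phi>_f] submatrix_full)
  also have "(\<Sum>a\<in>{0..<2 * n}. \<Sum>b\<in>{0..<2 * n}. ?h a b)
      = (\<Sum>i\<in>?S. \<Sum>j\<in>?S. x i j * (f i * f j)) + (\<Sum>i\<in>?S. \<Sum>j\<in>?S. - d i j * (f' i * f' j))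
      + ((\<Sum>i\<in>?S. \<Sum>j\<in>?S. if i = j then U * (f i * f' j) else 0)
      + (\<Sum>i\<in>?S. \<Sum>j\<in>?S. if i = j then - U * (f' i * f j) else 0))"
    unfolding sum_lessThan_double sum.distrib[symmetric]
  proof (intro sum.cong refl)
    fix i j assume "i \<in> ?S" "j \<in> ?S"
    then have *: "i < n" "j < n" by simp_all
    show "?h i j + ?h i (2 * n - 1 - j) + (?h (2 * n - 1 - i) j + ?h (2 * n - 1 - i) (2 * n - 1 - j))
      = x i j * (f i * f j) + - d i j * (f' i * f' j) + ((if i = j then U * (f i * f' j) else 0)
        + (if i = j then - U * (f' i * f j) else 0))"
      unfolding \<phi>[OF *] by (simp add: f'_def)
  qed
  \<comment> \<open>The two off-diagonal blocks agree, since the sign of the entry meets that of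
    exchanging the generators; together they absorb the factor 1/2.\<close>
  also have "(\<Sum>i\<in>?S. \<Sum>j\<in>?S. if i = j then - U * (f' i * f j) else 0)
      = (\<Sum>i\<in>?S. \<Sum>j\<in>?S. if i = j then U * (f i * f' j) else 0)"
  proof (intro sum.cong refl if_cong)
    fix i j
    have "f' i * f j = - (f j * f' i)"
      unfolding f'_def by (rule anticommutingD[OF anti])
    then show "- U * (f' i * f j) = U * (f i * f' j)" if "i = j"
      using that by simp
  qed
  also have "(\<Sum>i\<in>?S. \<Sum>j\<in>?S. if i = j then U * (f i * f' j) else 0) = U * Z"
    by (simp add: Z_def z_def sum_distrib_left)
  also have "(1 / 2) *\<^sub>R ((\<Sum>i\<in>?S. \<Sum>j\<in>?S. x i j * (f i * f j))
      + (\<Sum>i\<in>?S. \<Sum>j\<in>?S. - d i j * (f' i * f' j)) + (U * Z + U * Z)) = X + Y + U * Z"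
  proof -
    have "(1 / 2) *\<^sub>R (A + B + (C + C)) = (1 / 2) *\<^sub>R A + (1 / 2) *\<^sub>R B + C" for A B C :: 'a
      by (simp add: scaleR_add_right flip: scaleR_left_distrib)
    then show ?thesis
      by (simp only: X_def Y_def)
  qed
  finally show ?thesis
    by (simp only: power_sum_Pf)
qed

end

section \<open>Creation operators\<close>

text \<open>The exterior algebra with coefficients in \<open>'a\<close> is realised by creation operators on functions of
  sets of indices, the function supported at the empty set being the vacuum. Associativity is then
  that of composition, and applying a product to the vacuum reads off its top coefficient.\<close>

typedef (overloaded) 'a fock_op =
  "{T :: (nat set \<Rightarrow> 'a::real_algebra_1) \<Rightarrow> nat set \<Rightarrow> 'a.
    (\<forall>\<phi> \<psi>. T (\<lambda>S. \<phi> S + \<psi> S) = (\<lambda>S. T \<phi> S + T \<psi> S)) \<and>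
    (\<forall>r \<phi>. T (\<lambda>S. r *\<^sub>R \<phi> S) = (\<lambda>S. r *\<^sub>R T \<phi> S))}"
  morphisms apply_fock Abs_fock_op
  by (rule exI[of _ "\<lambda>\<phi>. \<phi>"]) simp

setup_lifting type_definition_fock_op

instantiation fock_op :: (real_algebra_1) real_algebra_1
begin

lift_definition zero_fock_op :: "'a fock_op" is "\<lambda>\<phi> S. 0" by simp
lift_definition one_fock_op :: "'a fock_op" is "\<lambda>\<phi>. \<phi>" by simp
lift_definition plus_fock_op :: "'a fock_op \<Rightarrow> 'a fock_op \<Rightarrow> 'a fock_op"
  is "\<lambda>T U \<phi> S. T \<phi> S + U \<phi> S" by (simp add: algebra_simps)
lift_definition minus_fock_op :: "'a fock_op \<Rightarrow> 'a fock_op \<Rightarrow> 'a fock_op"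
  is "\<lambda>T U \<phi> S. T \<phi> S - U \<phi> S" by (simp add: algebra_simps)
lift_definition uminus_fock_op :: "'a fock_op \<Rightarrow> 'a fock_op"
  is "\<lambda>T \<phi> S. - T \<phi> S" by simp
lift_definition times_fock_op :: "'a fock_op \<Rightarrow> 'a fock_op \<Rightarrow> 'a fock_op"
  is "\<lambda>T U \<phi>. T (U \<phi>)" by simp
lift_definition scaleR_fock_op :: "real \<Rightarrow> 'a fock_op \<Rightarrow> 'a fock_op"
  is "\<lambda>r T \<phi> S. r *\<^sub>R T \<phi> S" by (simp add: scaleR_add_right mult.commute)

instance
proof
  fix T U V :: "'a fock_op" and r s :: real
  show "T + U + V = T + (U + V)" by transfer (simp add: add.assoc)
  show "T + U = U + T" by transfer (simp add: add.commute)
  show "0 + T = T" by transfer simp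
  show "- T + T = 0" by transfer simp
  show "T - U = T + - U" by transfer simp
  show "T * U * V = T * (U * V)" by transfer simp
  show "1 * T = T" by transfer simp
  show "T * 1 = T" by transfer simp
  show "(T + U) * V = T * V + U * V" by transfer simp
  show "T * (U + V) = T * U + T * V" by transfer simp
  show "r *\<^sub>R (T + U) = r *\<^sub>R T + r *\<^sub>R U" by transfer (simp add: scaleR_add_right)
  show "(r + s) *\<^sub>R T = r *\<^sub>R T + s *\<^sub>R T" by transfer (simp add: scaleR_add_left)
  show "r *\<^sub>R s *\<^sub>R T = (r * s) *\<^sub>R T" by transfer simp
  show "1 *\<^sub>R T = T" by transfer simp
  show "r *\<^sub>R T * U = r *\<^sub>R (T * U)" by transfer simp
  show "T * r *\<^sub>R U = r *\<^sub>R (T * U)" by transfer simp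
  show "(0 :: 'a fock_op) \<noteq> 1"
  proof (transfer, rule notI)
    assume "(\<lambda>\<phi> S. 0) = (\<lambda>\<phi> :: nat set \<Rightarrow> 'a. \<phi>)"
    from fun_cong[OF fun_cong[OF this, of "\<lambda>_. 1"]] show False by simp
  qed
qed

end

lift_definition coeff_op :: "'a::real_algebra_1 \<Rightarrow> 'a fock_op" is "\<lambda>a \<phi> S. a * \<phi> S"
  by (simp add: distrib_left)

text \<open>Left multiplication by e_i, where a function stands for the sum of its values times the
  monomials e_S. The sign counts the generators that e_i crosses to reach its place in increasing
  order.\<close>

lift_definition creation_op :: "nat \<Rightarrow> 'a::real_algebra_1 fock_op" is
  "\<lambda>i \<phi> S. if i \<in> S then (- 1) ^ card {j \<in> S. j < i} * \<phi> (S - {i}) else 0"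
  by (auto simp: distrib_left fun_eq_iff)

lemma coeff_op_0: "coeff_op 0 = 0" and coeff_op_1: "coeff_op 1 = 1"
  and coeff_op_add: "coeff_op (a + b) = coeff_op a + coeff_op b"
  and coeff_op_diff: "coeff_op (a - b) = coeff_op a - coeff_op b"
  and coeff_op_uminus: "coeff_op (- a) = - coeff_op a"
  and coeff_op_mult: "coeff_op (a * b) = coeff_op a * coeff_op b"
  and coeff_op_scaleR: "coeff_op (r *\<^sub>R a) = r *\<^sub>R coeff_op a"
  by (transfer; simp add: fun_eq_iff algebra_simps)+

lemma coeff_op_sum: "coeff_op (\<Sum>i\<in>A. g i) = (\<Sum>i\<in>A. coeff_op (g i))"
  by (induction A rule: infinite_finite_induct) (simp_all add: coeff_op_0 coeff_op_add)

lemma coeff_op_prod_list: "coeff_op (prod_list xs) = prod_list (map coeff_op xs)"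
  by (induction xs) (simp_all add: coeff_op_1 coeff_op_mult)

lemma coeff_op_of_int: "coeff_op (of_int k) = of_int k"
proof -
  have "coeff_op (of_int k) = coeff_op (real_of_int k *\<^sub>R 1)"
    by (simp add: scaleR_conv_of_real)
  also have "\<dots> = of_int k"
    unfolding coeff_op_scaleR coeff_op_1 by (simp add: scaleR_conv_of_real)
  finally show ?thesis .
qed

lemma coeff_op_Pf_submatrix:
  assumes I: "I \<subseteq> {0..<n}" "card I = 2 * k"
  shows "coeff_op (Pf (submatrix (mat n n (\<lambda>(i, j). a i j)) I I))
    = Pf (submatrix (mat n n (\<lambda>(i, j). coeff_op (a i j))) I I)"
  unfolding Pf_submatrix[OF I]
  by (simp add: coeff_op_scaleR coeff_op_sum coeff_op_mult coeff_op_of_int coeff_op_prod_list o_def)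

lemma coeff_op_creation_op: "coeff_op a * creation_op i = creation_op i * coeff_op a"
  by transfer (auto simp: fun_eq_iff minus_one_power_iff)

lemma anticommuting_creation_op: "anticommuting (creation_op :: nat \<Rightarrow> 'a::real_algebra_1 fock_op)"
proof -
  have less: "creation_op i * creation_op j = - (creation_op j * creation_op i :: 'a fock_op)"
    if "i < j" for i j
  proof (transfer fixing: i j, intro ext)
    fix \<phi> :: "nat set \<Rightarrow> 'a" and S
    let ?s = "\<lambda>i S. (- 1) ^ card {k \<in> S. k < i} :: 'a"
    show "(if i \<in> S then ?s i S * (if j \<in> S - {i} then ?s j (S - {i}) * \<phi> (S - {i} - {j}) else 0) else 0)
      = - (if j \<in> S then ?s j S * (if i \<in> S - {j} then ?s i (S - {j}) * \<phi> (S - {j} - {i}) else 0) else 0)"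
    proof (cases "i \<in> S \<and> j \<in> S")
      case True
      \<comment> \<open>For i < j, removing j does not affect the count for i, whereas removing i
        lowers the count for j by one. This asymmetry is the sign.\<close>
      have "{k \<in> S - {j}. k < i} = {k \<in> S. k < i}"
        using that by auto
      moreover have "{k \<in> S. k < j} = insert i {k \<in> S - {i}. k < j}"
        using that True by auto
      then have "card {k \<in> S. k < j} = Suc (card {k \<in> S - {i}. k < j})"
        by simp
      moreover have "S - {i} - {j} = S - {j} - {i}"
        by auto
      moreover have "j \<in> S - {i}" "i \<in> S - {j}"
        using True that by auto
      ultimately show ?thesis
        using True by (simp only: if_True simp_thms) (simp add: minus_one_power_iff)
    qed auto
  qed
  have square: "creation_op i * creation_op i = (0 :: 'a fock_op)" for i
    by transfer (auto simp: fun_eq_iff)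
  show ?thesis
    unfolding anticommuting_def
  proof (intro allI)
    fix i j :: nat
    consider "i < j" | "i = j" | "j < i" by linarith
    then show "creation_op i * creation_op j = - (creation_op j * creation_op i :: 'a fock_op)"
      by cases (simp_all only: less square minus_minus minus_zero)
  qed
qed

text \<open>The leftmost operator acts last, hence the downward induction; its index is below all
  those already present, so no sign appears.\<close>

lemma apply_creation_ops:
  assumes "m \<le> N"
  shows "apply_fock (prod_list (map creation_op [m..<N])) (\<lambda>S. if S = {} then 1 else 0)
    = (\<lambda>S. if S = {m..<N} then 1 else (0 :: 'a::real_algebra_1))"
  using assms
proof (induction m rule: inc_induct)
  case base
  then show ?case by (simp add: one_fock_op.rep_eq)
next
  case (step m)
  show ?case
  proof
    fix S
    have interval: "{m..<N} = insert m {Suc m..<N}" "m \<notin> {Suc m..<N}"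
      using step.hyps by auto
    have upt: "[m..<N] = m # [Suc m..<N]"
      using step.hyps by (simp add: upt_conv_Cons)
    have *: "apply_fock (prod_list (map creation_op [m..<N])) (\<lambda>S. if S = {} then 1 else 0) S
      = (if m \<in> S then (- 1) ^ card {j \<in> S. j < m} * (if S - {m} = {Suc m..<N} then 1 else 0) else (0 :: 'a))"
      unfolding upt list.map prod_list.Cons times_fock_op.rep_eq step.IH creation_op.rep_eq ..
    show "apply_fock (prod_list (map creation_op [m..<N])) (\<lambda>S. if S = {} then 1 else 0) S
      = (if S = {m..<N} then 1 else (0 :: 'a))"
    proof (cases "S = {m..<N}")
      case True
      then have "m \<in> S" "S - {m} = {Suc m..<N}" "{j \<in> S. j < m} = {}"
        using interval by auto
      then show ?thesis
        unfolding * using True by (simp only: if_True refl card.empty power_0 mult_1_left)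
    next
      case False
      then have "\<not> (m \<in> S \<and> S - {m} = {Suc m..<N})"
        using interval(1) insert_Diff[of m S] by auto
      then show ?thesis
        unfolding * using False by (cases "m \<in> S") (simp_all only: simp_thms if_True if_False mult_zero_right)
    qed
  qed
qed

text \<open>Evaluating at the full set after acting on the vacuum recovers the coefficient, which
  turns \<open>Pf_block\<close> into an identity without generators.\<close>

lemma coeff_op_ordered_prod_cancel:
  assumes "coeff_op a * ordered_prod creation_op {0..<N} = coeff_op b * ordered_prod creation_op {0..<N}"
  shows "a = b"
proof -
  have "apply_fock (coeff_op c * ordered_prod creation_op {0..<N}) (\<lambda>S. if S = {} then 1 else 0) {0..<N} = c"
    for c :: 'a
    by (simp add: ordered_prod_def times_fock_op.rep_eq coeff_op.rep_eq apply_creation_ops)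
  from trans[OF this[of a, symmetric, unfolded assms] this[of b]] show ?thesis .
qed

section \<open>Differential operators on alternating matrices\<close>

lemma apply_op_add: "apply_op P (p + q) = apply_op P p + apply_op P q"
  using apply_op[of P] by (simp add: clinear_op_iff)

lemma partial_deriv_single:
  "partial_deriv v (Poly_Mapping.single m c)
    = Poly_Mapping.single (m - Poly_Mapping.single v 1) (of_nat (Poly_Mapping.lookup m v) * c)"
  by (simp add: partial_deriv_def)

lemma partial_deriv_pvar_single:
  "partial_deriv v (pvar w * Poly_Mapping.single m c)
    = pvar w * partial_deriv v (Poly_Mapping.single m c)
      + (if v = w then Poly_Mapping.single m c else 0)"
proof -
  let ?e = "\<lambda>v. Poly_Mapping.single v (1 :: nat)"
  \<comment> \<open>Subtraction of exponents is truncated; where it would differ, the exponent of v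
    is 0 and the coefficient vanishes.\<close>
  have "?e w + m - ?e v = ?e w + (m - ?e v)" if "Poly_Mapping.lookup m v > 0"
    using that by (intro poly_mapping_eqI) (auto simp: lookup_add lookup_minus lookup_single when_def)
  then have "Poly_Mapping.single (?e w + m - ?e v) (of_nat (Poly_Mapping.lookup m v) * c)
      = Poly_Mapping.single (?e w + (m - ?e v)) (of_nat (Poly_Mapping.lookup m v) * c)"
    by (cases "Poly_Mapping.lookup m v > 0") auto
  then show ?thesis
    by (auto simp: pvar_def mult_single partial_deriv_single lookup_add lookup_single when_def
        distrib_right single_add)
qed

lemma partial_deriv_pvar:
  "partial_deriv v (pvar w * p) = pvar w * partial_deriv v p + (if v = w then p else 0)"
proof -
  have add: "partial_deriv v (p + q) = partial_deriv v p + partial_deriv v q" for p q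
    using apply_op_add[of "deriv_op v"] by (simp add: deriv_op.rep_eq)
  show ?thesis
  proof (induction p rule: update_induct)
    case const
    show ?case by (simp add: partial_deriv_def)
  next
    case (update p m c)
    have "Poly_Mapping.update m c p = p + Poly_Mapping.single m c"
      using update(1)
      by (intro poly_mapping_eqI) (auto simp: lookup_update lookup_add lookup_single when_def in_keys_iff)
    then show ?case
      by (simp add: distrib_left add update.IH partial_deriv_pvar_single)
  qed
qed

lemma deriv_op_mult_op:
  "deriv_op v * mult_op (pvar w) = mult_op (pvar w) * deriv_op v + of_bool (v = w)"
  by (intro apply_op_inject[THEN iffD1] ext)
    (simp add: times_alt_op.rep_eq plus_alt_op.rep_eq deriv_op.rep_eq apply_mult_op partial_deriv_pvar
      zero_alt_op.rep_eq one_alt_op.rep_eq)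

text \<open>Valid for all indices: order reversal in either pair changes the sign of both sides, and
  for i = j or k = l the two deltas cancel.\<close>

lemma d_op_x_op:
  "d_op k l * x_op i j = x_op i j * d_op k l + (of_bool (k = i \<and> l = j) - of_bool (k = j \<and> l = i))"
  by (auto simp: d_op_def x_op_def deriv_op_mult_op)

section \<open>Complex scalars and closure properties of the ring of differential operators\<close>

lemma cscale_mult: "(c *\<^sub>C P) * Q = c *\<^sub>C (P * Q)" "P * (c *\<^sub>C Q) = c *\<^sub>C (P * Q)"
  by (transfer; simp add: clinear_op_iff fun_eq_iff)+

lemma cscale_cscale: "a *\<^sub>C b *\<^sub>C P = (a * b) *\<^sub>C P"
  by transfer simp

lemma cscale_add: "(a + b) *\<^sub>C P = a *\<^sub>C P + b *\<^sub>C P"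
  by transfer (simp add: pscale.scale_left_distrib)

lemma cscale_1: "1 *\<^sub>C P = P" and cscale_0: "0 *\<^sub>C P = 0"
  by (transfer; simp)+

lemma PD_cscale: "P \<in> PD n \<Longrightarrow> c *\<^sub>C P \<in> PD n"
  using PD.mult[OF PD.scalar[of c n], of P] by (simp add: cscale_mult)

lemma PD_0: "0 \<in> PD n"
  using PD.scalar[of 0 n] by (simp add: cscale_0)

lemma PD_1: "1 \<in> PD n"
  using PD.scalar[of 1 n] by (simp add: cscale_1)

lemma PD_scaleR: "P \<in> PD n \<Longrightarrow> r *\<^sub>R P \<in> PD n"
  by (simp add: scaleR_alt_op_def PD_cscale)

lemma PD_uminus: "P \<in> PD n \<Longrightarrow> - P \<in> PD n"
  using PD_scaleR[of P n "- 1"] by simp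

lemma PD_of_int: "of_int k \<in> PD n"
  using PD_scaleR[OF PD_1[of n], of "real_of_int k"] by (simp add: scaleR_conv_of_real)

lemma PD_sum: "(\<And>i. i \<in> A \<Longrightarrow> g i \<in> PD n) \<Longrightarrow> (\<Sum>i\<in>A. g i) \<in> PD n"
  by (induction A rule: infinite_finite_induct) (auto intro: PD_0 PD.add)

lemma PD_prod_list: "(\<And>P. P \<in> set Ps \<Longrightarrow> P \<in> PD n) \<Longrightarrow> prod_list Ps \<in> PD n"
  by (induction Ps) (auto intro: PD_1 PD.mult)

lemma PD_Pf:
  assumes "\<And>i j. i < dim_row A \<Longrightarrow> j < dim_row A \<Longrightarrow> A $$ (i, j) \<in> PD n"
  shows "Pf A \<in> PD n"
proof -
  have "A $$ (\<sigma> (2 * l), \<sigma> (2 * l + 1)) \<in> PD n"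
    if "\<sigma> permutes {0..<2 * (dim_row A div 2)}" "l < dim_row A div 2" for \<sigma> l
  proof -
    have "\<sigma> i < 2 * (dim_row A div 2)" if "i < 2 * (dim_row A div 2)" for i
      using permutes_in_image[OF \<open>\<sigma> permutes _\<close>, of i] that by simp
    from this[of "2 * l"] this[of "2 * l + 1"] that(2) show ?thesis
      by (intro assms) linarith+
  qed
  then show ?thesis
    unfolding Pf_def Let_def
    by (intro PD_scaleR PD_sum PD.mult PD_of_int PD_prod_list) auto
qed

section \<open>The polynomials a_m\<close>

text \<open>Padding with zeros gives sums of different lengths a common range, so that they can be
  compared term by term.\<close>

lemma poly_a_poly_extend:
  assumes "m div 2 \<le> N"
  shows "poly (a_poly m) u = (\<Sum>k=0..N. if 2 * k \<le> m
    then fact m / (4 ^ k * fact (m - 2 * k) * fact k) * u ^ (m - 2 * k) else 0)"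
proof -
  have "poly (a_poly m) u
      = (\<Sum>k=0..m div 2. fact m / (4 ^ k * fact (m - 2 * k) * fact k) * u ^ (m - 2 * k))"
    by (simp add: a_poly_def poly_sum poly_monom power_mult)
  also have "\<dots> = (\<Sum>k=0..N. if 2 * k \<le> m
    then fact m / (4 ^ k * fact (m - 2 * k) * fact k) * u ^ (m - 2 * k) else 0)"
    using assms by (intro sum.mono_neutral_cong_left) auto
  finally show ?thesis .
qed

lemma poly_a_poly_0: "poly (a_poly 0) u = 1"
  by (simp add: a_poly_def poly_monom)

text \<open>The exponential generating series of the a_m(u) is exp(ut + t^2/4), whose derivative is
  u + t/2 times itself. The resulting recurrence is checked here on the summands, with k + 1 on the
  left matched to k in the last term.\<close>

lemma poly_a_poly_Suc:
  "poly (a_poly (Suc m)) u = u * poly (a_poly m) u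
    + (if m = 0 then 0 else of_nat m / 2 * poly (a_poly (m - 1)) u)"
proof -
  let ?t = "\<lambda>m k. if 2 * k \<le> m
    then fact m / (4 ^ k * fact (m - 2 * k) * fact k) * u ^ (m - 2 * k) else (0 :: complex)"
  have ne: "(of_nat k :: complex) + 1 \<noteq> 0" for k
    by (metis of_nat_Suc of_nat_neq_0 add.commute)
  have ne4: "4 + (of_nat k :: complex) * 4 \<noteq> 0" for k
  proof -
    have "4 + (of_nat k :: complex) * 4 = 4 * (of_nat k + 1)"
      by (simp add: algebra_simps)
    then show ?thesis using ne[of k] by (simp only: mult_eq_0_iff) simp
  qed
  have Suc: "?t (Suc m) (Suc k) = u * ?t m (Suc k)
      + (if m = 0 then 0 else of_nat m / 2 * ?t (m - 1) k)" for k
  proof -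
    \<comment> \<open>Either all terms vanish, or the left side is the constant term and
      \<open>?t m (Suc k)\<close> vanishes, or all exponents are genuine differences.\<close>
    consider "Suc m < 2 * Suc k" | "Suc m = 2 * Suc k" | r where "m = 2 * Suc k + r"
      by (metis less_Suc_eq not_less_eq le_Suc_ex linorder_neqE_nat not_le_imp_less)
    then show ?thesis
    proof cases
      case 1
      then show ?thesis by auto
    next
      case 2
      then have m: "m = Suc (2 * k)" by simp
      show ?thesis
        using ne[of k] ne4[of k] by (simp add: m divide_simps) (simp add: algebra_simps)
    next
      case 3
      have "m - 1 = Suc (2 * k + r)" "m - Suc (2 * k) = Suc r" "m - 2 * k - 1 = Suc r"
        using 3 by simp_all
      then show ?thesis
        using ne[of k] ne[of r] ne4[of k] by (simp add: 3 divide_simps) (simp add: algebra_simps)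
    qed
  qed
  have "poly (a_poly (Suc m)) u = (\<Sum>k=0..Suc m. ?t (Suc m) k)"
    by (rule poly_a_poly_extend) simp
  also have "\<dots> = ?t (Suc m) 0 + (\<Sum>k=0..m. ?t (Suc m) (Suc k))"
    by (simp only: sum.atLeast0_atMost_Suc_shift o_def)
  also have "\<dots> = u * (?t m 0 + (\<Sum>k=0..m. ?t m (Suc k)))
      + (if m = 0 then 0 else of_nat m / 2 * (\<Sum>k=0..m. ?t (m - 1) k))"
    unfolding Suc by (simp add: sum.distrib sum_distrib_left distrib_left del: fact_Suc)
  also have "?t m 0 + (\<Sum>k=0..m. ?t m (Suc k)) = (\<Sum>k=0..Suc m. ?t m k)"
    by (simp only: sum.atLeast0_atMost_Suc_shift o_def)
  also have "\<dots> = poly (a_poly m) u"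
    by (rule poly_a_poly_extend[symmetric]) simp
  also have "(\<Sum>k=0..m. ?t (m - 1) k) = poly (a_poly (m - 1)) u"
    by (rule poly_a_poly_extend[symmetric]) simp
  finally show ?thesis .
qed

lemma lead_coeff_a_poly: "lead_coeff (a_poly m) = 1"
proof -
  have "coeff (a_poly m) m = (\<Sum>k=0..m div 2. if k = 0 then 1 else 0)"
    unfolding a_poly_def coeff_sum by (intro sum.cong refl) auto
  then have "coeff (a_poly m) m = 1"
    by simp
  moreover have "degree (a_poly m) \<le> m"
    unfolding a_poly_def by (intro degree_sum_le) (auto intro: order_trans[OF degree_monom_le])
  ultimately show ?thesis
    by (metis le_antisym le_degree one_neq_zero)
qed

section \<open>Entries of the block matrix\<close>

lemma exchange_mat_carrier: "exchange_mat m \<in> carrier_mat m m"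
  by (simp add: exchange_mat_def)

lemma mult_exchange_mat_index:
  fixes A :: "'a::ring_1 mat"
  assumes "A \<in> carrier_mat r m" "i < r" "j < m"
  shows "(A * exchange_mat m) $$ (i, j) = A $$ (i, m - 1 - j)"
proof -
  have "(A * exchange_mat m) $$ (i, j) = (\<Sum>k=0..<m. A $$ (i, k) * (if k + j + 1 = m then 1 else 0))"
    using assms by (simp add: scalar_prod_def exchange_mat_def)
  also have "\<dots> = (\<Sum>k=0..<m. if k = m - 1 - j then A $$ (i, k) else 0)"
    by (intro sum.cong refl) (use assms in auto)
  finally have "(A * exchange_mat m) $$ (i, j) = (\<Sum>k=0..<m. if k = m - 1 - j then A $$ (i, k) else 0)" .
  then show ?thesis using assms by simp
qed

lemma exchange_mat_mult_index:
  fixes A :: "'a::ring_1 mat"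
  assumes "A \<in> carrier_mat m r" "i < m" "j < r"
  shows "(exchange_mat m * A) $$ (i, j) = A $$ (m - 1 - i, j)"
proof -
  have "(exchange_mat m * A) $$ (i, j) = (\<Sum>k=0..<m. (if i + k + 1 = m then 1 else 0) * A $$ (k, j))"
    using assms by (simp add: scalar_prod_def exchange_mat_def)
  also have "\<dots> = (\<Sum>k=0..<m. if k = m - 1 - i then A $$ (k, j) else 0)"
    by (intro sum.cong refl) (use assms in auto)
  finally have "(exchange_mat m * A) $$ (i, j) = (\<Sum>k=0..<m. if k = m - 1 - i then A $$ (k, j) else 0)" .
  then show ?thesis using assms by simp
qed

lemma Phi_tilde_carrier: "Phi_tilde n u \<in> carrier_mat (2 * n) (2 * n)"
  unfolding Phi_tilde_def mult_2
  by (intro four_block_carrier_mat uminus_carrier_mat mult_carrier_mat[of _ n n] exchange_mat_carrier)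
    (simp_all add: M_mat_def D_mat_def)

text \<open>Multiplication by the exchange matrix reverses the columns, and reversing them twice
  restores \<open>Phi_tilde n u\<close>.\<close>

lemma Pf_anti_Phi: "Pf_anti (Phi n u) = Pf (Phi_tilde n u)"
proof -
  have "Phi n u * exchange_mat (2 * n) = Phi_tilde n u"
  proof (rule eq_matI)
    fix i j assume ij: "i < dim_row (Phi_tilde n u)" "j < dim_col (Phi_tilde n u)"
    then have "i < 2 * n" "j < 2 * n"
      using Phi_tilde_carrier[of n u] by auto
    moreover have "Phi n u \<in> carrier_mat (2 * n) (2 * n)"
      using Phi_tilde_carrier exchange_mat_carrier unfolding Phi_def by (rule mult_carrier_mat)
    ultimately show "(Phi n u * exchange_mat (2 * n)) $$ (i, j) = Phi_tilde n u $$ (i, j)"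
      using Phi_tilde_carrier[of n u]
      by (simp add: mult_exchange_mat_index[of _ "2 * n"] Phi_def del: index_mult_mat)
  qed (use Phi_tilde_carrier[of n u] in \<open>auto simp: Phi_def exchange_mat_def\<close>)
  moreover have "dim_row (Phi n u) = 2 * n"
    using Phi_tilde_carrier[of n u] by (simp add: Phi_def)
  ultimately show ?thesis
    by (simp add: Pf_anti_def)
qed

text \<open>Indexing the second half by partners matches \<open>Pf_block\<close>: conjugation by the
  exchange matrix reverses both indices of D, and the partner indices reverse them back.\<close>

lemma Phi_tilde_index:
  assumes ij: "i < n" "j < n"
  shows "Phi_tilde n u $$ (i, j) = x_op i j"
    and "Phi_tilde n u $$ (i, 2 * n - 1 - j) = (if i = j then u *\<^sub>C 1 else 0)"
    and "Phi_tilde n u $$ (2 * n - 1 - i, j) = (if i = j then - (u *\<^sub>C 1) else 0)"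
    and "Phi_tilde n u $$ (2 * n - 1 - i, 2 * n - 1 - j) = - d_op i j"
proof -
  have idx: "\<not> 2 * n - 1 - i < n" "2 * n - 1 - i < n + n" "2 * n - 1 - i - n = n - 1 - i"
    "\<not> 2 * n - 1 - j < n" "2 * n - 1 - j < n + n" "2 * n - 1 - j - n = n - 1 - j"
    "n - 1 - i < n" "n - 1 - j < n" "n - 1 - (n - 1 - i) = i" "n - 1 - (n - 1 - j) = j"
    using ij by auto
  have dims: "dim_row (M_mat n) = n" "dim_col (M_mat n) = n" "D_mat n \<in> carrier_mat n n"
    "exchange_mat n * D_mat n \<in> carrier_mat n n"
    by (auto simp: M_mat_def D_mat_def intro!: mult_carrier_mat[of _ n n] exchange_mat_carrier)
  show "Phi_tilde n u $$ (i, j) = x_op i j"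
    using ij by (simp add: Phi_tilde_def dims) (simp add: M_mat_def)
  show "Phi_tilde n u $$ (i, 2 * n - 1 - j) = (if i = j then u *\<^sub>C 1 else 0)"
    using ij idx by (auto simp: Phi_tilde_def dims exchange_mat_def D_mat_def M_mat_def)
  show "Phi_tilde n u $$ (2 * n - 1 - i, j) = (if i = j then - (u *\<^sub>C 1) else 0)"
    using ij idx by (auto simp: Phi_tilde_def dims exchange_mat_def D_mat_def M_mat_def)
  have "(exchange_mat n * D_mat n * exchange_mat n) $$ (n - 1 - i, n - 1 - j) = d_op i j"
    using ij idx by (simp add: mult_exchange_mat_index[OF dims(4)] exchange_mat_mult_index[OF dims(3)]
        del: index_mult_mat) (simp add: D_mat_def)
  moreover have "Phi_tilde n u $$ (2 * n - 1 - i, 2 * n - 1 - j)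
      = - ((exchange_mat n * D_mat n * exchange_mat n) $$ (n - 1 - i, n - 1 - j))"
    using ij idx unfolding Phi_tilde_def
    by (subst index_mat_four_block) (simp_all add: dims D_mat_def exchange_mat_def del: index_mult_mat(1))
  ultimately show "Phi_tilde n u $$ (2 * n - 1 - i, 2 * n - 1 - j) = - d_op i j"
    by simp
qed

lemma less_double_cases:
  fixes a :: nat
  assumes "a < 2 * n"
  obtains i where "i < n" "a = i" | i where "i < n" "a = 2 * n - 1 - i"
proof (cases "a < n")
  case False
  show ?thesis
    by (rule that(2)[of "2 * n - 1 - a"]) (use assms False in auto)
qed (use that in blast)

section \<open>The identity for the differential operators\<close>

theorem Pf_Phi_tilde:
  "Pf (Phi_tilde n u) = (\<Sum>k=0..n div 2. poly (a_poly (n - 2 * k)) u *\<^sub>C Gamma_op n k)"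
proof -
  let ?c = "coeff_op :: alt_op \<Rightarrow> alt_op fock_op"
  let ?e = "creation_op :: nat \<Rightarrow> alt_op fock_op"
  \<comment> \<open>A function on all index pairs, 0 outside the matrix, since
    \<open>Pf_block\<close> takes entries and not a matrix.\<close>
  define \<phi> where "\<phi> a b = (if a < 2 * n \<and> b < 2 * n then Phi_tilde n u $$ (a, b) else 0)" for a b
  let ?\<alpha> = "\<lambda>m. poly (a_poly m) u *\<^sub>C (1 :: alt_op)"
  interpret weyl_pairs ?e n "\<lambda>i j. ?c (x_op i j)" "\<lambda>i j. ?c (d_op i j)" "?c (u *\<^sub>C 1)" "\<lambda>m. ?c (?\<alpha> m)"
  proof
    have of_bool: "?c (of_bool b) = of_bool b" for b
      by (simp add: coeff_op_0 coeff_op_1)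
    show "?c (d_op k l) * ?c (x_op i j) = ?c (x_op i j) * ?c (d_op k l)
        + (of_bool (k = i \<and> l = j) - of_bool (k = j \<and> l = i))" for i j k l
      unfolding of_bool[symmetric] by (simp only: d_op_x_op flip: coeff_op_mult coeff_op_add coeff_op_diff)
    fix m
    have "?\<alpha> (Suc m) = (u *\<^sub>C 1) * ?\<alpha> m + (if m = 0 then 0 else (real m / 2) *\<^sub>R ?\<alpha> (m - 1))"
      by (cases "m = 0") (simp_all add: poly_a_poly_Suc cscale_add cscale_mult(1) cscale_cscale
          scaleR_alt_op_def)
    then show "?c (?\<alpha> (Suc m)) = ?c (u *\<^sub>C 1) * ?c (?\<alpha> m)
        + (if m = 0 then 0 else (real m / 2) *\<^sub>R ?c (?\<alpha> (m - 1)))"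
      by (simp add: coeff_op_0 coeff_op_add coeff_op_mult coeff_op_scaleR)
  qed (simp_all add: anticommuting_creation_op coeff_op_creation_op poly_a_poly_0 cscale_1 coeff_op_1
      cscale_mult flip: coeff_op_mult)
  have \<phi>_index: "?c (\<phi> i j) = ?c (x_op i j)"
    "?c (\<phi> i (2 * n - 1 - j)) = (if i = j then ?c (u *\<^sub>C 1) else 0)"
    "?c (\<phi> (2 * n - 1 - i) j) = (if i = j then - ?c (u *\<^sub>C 1) else 0)"
    "?c (\<phi> (2 * n - 1 - i) (2 * n - 1 - j)) = - ?c (d_op i j)" if "i < n" "j < n" for i j
  proof -
    have "i < 2 * n" "j < 2 * n" "2 * n - 1 - i < 2 * n" "2 * n - 1 - j < 2 * n"
      using that by auto
    then show "?c (\<phi> i j) = ?c (x_op i j)"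
      "?c (\<phi> i (2 * n - 1 - j)) = (if i = j then ?c (u *\<^sub>C 1) else 0)"
      "?c (\<phi> (2 * n - 1 - i) j) = (if i = j then - ?c (u *\<^sub>C 1) else 0)"
      "?c (\<phi> (2 * n - 1 - i) (2 * n - 1 - j)) = - ?c (d_op i j)"
      by (simp_all only: \<phi>_def Phi_tilde_index[OF that] simp_thms if_True)
        (simp_all add: coeff_op_0 coeff_op_uminus)
  qed
  \<comment> \<open>Written as a minor so that the compatibility of \<open>coeff_op\<close> with
    Pfaffians of submatrices applies.\<close>
  have "Phi_tilde n u = submatrix (mat (2 * n) (2 * n) (\<lambda>(a, b). \<phi> a b)) {0..<2 * n} {0..<2 * n}"
    unfolding submatrix_full using Phi_tilde_carrier[of n u] by (intro eq_matI) (auto simp: \<phi>_def)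
  then have "?c (Pf (Phi_tilde n u)) = Pf (mat (2 * n) (2 * n) (\<lambda>(a, b). ?c (\<phi> a b)))"
    using coeff_op_Pf_submatrix[of "{0..<2 * n}" "2 * n" n \<phi>] by (simp add: submatrix_full)
  also have "\<dots> * ordered_prod ?e {0..<2 * n} = (\<Sum>k=0..n div 2.
      (\<Sum>I | I \<subseteq> {0..<n} \<and> card I = 2 * k. Pfx I * Pfd I) * ?c (?\<alpha> (n - 2 * k)))
      * ordered_prod ?e {0..<2 * n}"
    by (rule Pf_block) (erule (1) \<phi>_index | rule coeff_op_creation_op)+
  also have "(\<Sum>k=0..n div 2. (\<Sum>I | I \<subseteq> {0..<n} \<and> card I = 2 * k. Pfx I * Pfd I) * ?c (?\<alpha> (n - 2 * k)))
      = ?c (\<Sum>k=0..n div 2. poly (a_poly (n - 2 * k)) u *\<^sub>C Gamma_op n k)"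
    unfolding coeff_op_sum
  proof (rule sum.cong[OF refl])
    fix k
    have "(\<Sum>I | I \<subseteq> {0..<n} \<and> card I = 2 * k. Pfx I * Pfd I) = ?c (Gamma_op n k)"
      unfolding Gamma_op_def coeff_op_sum M_mat_def D_mat_def
      by (rule sum.cong[OF refl]) (auto simp: coeff_op_mult coeff_op_Pf_submatrix)
    then show "(\<Sum>I | I \<subseteq> {0..<n} \<and> card I = 2 * k. Pfx I * Pfd I) * ?c (?\<alpha> (n - 2 * k))
        = ?c (poly (a_poly (n - 2 * k)) u *\<^sub>C Gamma_op n k)"
      by (simp add: cscale_mult flip: coeff_op_mult)
  qed
  finally show ?thesis
    by (rule coeff_op_ordered_prod_cancel)
qed

lemma Pf_Phi_tilde_in_PD: "Pf (Phi_tilde n u) \<in> PD n"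
proof (rule PD_Pf)
  have x: "x_op i j \<in> PD n" and d: "d_op i j \<in> PD n" if "i < n" "j < n" for i j
    using that PD.x_op[of i j n] PD.x_op[of j i n] PD.d_op[of i j n] PD.d_op[of j i n]
      PD_uminus[of "x_op j i" n] PD_uminus[of "d_op j i" n]
    by (auto simp: x_op_def d_op_def PD_0 split: if_splits)
  fix a b assume "a < dim_row (Phi_tilde n u)" "b < dim_row (Phi_tilde n u)"
  then have "a < 2 * n" "b < 2 * n"
    using Phi_tilde_carrier[of n u] by auto
  then show "Phi_tilde n u $$ (a, b) \<in> PD n"
    by (elim less_double_cases) (auto simp: Phi_tilde_index[simplified] x d PD_uminus PD_0 PD.scalar)
qed

theorem theorem3p5:
  fixes n :: nat and u :: complex
  assumes "n \<ge> 1"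
  shows "Pf_anti (Phi n u) \<in> PD n
    \<and> Pf_anti (Phi n u) = (\<Sum>k = 0..n div 2. poly (a_poly (n - 2 * k)) u *\<^sub>C Gamma_op n k)
    \<and> (\<forall>m. lead_coeff (a_poly m) = 1)"
  unfolding Pf_anti_Phi using Pf_Phi_tilde_in_PD Pf_Phi_tilde lead_coeff_a_poly by blast

end
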